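(* Let $H$ be a connected bipartite graph with minimum feedback vertex number $1$. Suppose $2k^\ast$ is the length of the shortest cycle contained in $H$. Then $\operatorname{ex}(n,H)=O(n^{1+1/k^\ast})$ as $n\to\infty$, where the implied constant depends only on $H$.
   Context: All graphs are finite and simple. The extremal number $\operatorname{ex}(n,H)$ is the maximum number of edges in a graph on $n$ vertices that contains no (not necessarily induced) subgraph isomorphic to $H$. A feedback vertex set of a graph is a set of vertices whose removal results in an acyclic graph; the minimum feedback vertex number is the minimum size of a feedback vertex set. Thus minimum feedback vertex number $1$ means that the graph contains a cycle and has a single vertex whose removal leaves a forest. *)

theory Defs
  imports Complex_Main "HOL-Library.Landau_Symbols"
begin

record 'a ugraph =
  verts :: "'a set"
  edges :: "'a set set"

definition simple_graph :: "'a ugraph \<Rightarrow> bool" where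
  "simple_graph G \<longleftrightarrow> finite (verts G) \<and> (\<forall>e\<in>edges G. e \<subseteq> verts G \<and> card e = 2)"

definition is_subgraph :: "'a ugraph \<Rightarrow> 'a ugraph \<Rightarrow> bool" where
  "is_subgraph F G \<longleftrightarrow> simple_graph F \<and> verts F \<subseteq> verts G \<and> edges F \<subseteq> edges G"

definition graph_iso :: "'a ugraph \<Rightarrow> 'b ugraph \<Rightarrow> bool" where
  "graph_iso G G' \<longleftrightarrow>
     (\<exists>f. bij_betw f (verts G) (verts G') \<and>
          (\<forall>u\<in>verts G. \<forall>v\<in>verts G. {u, v} \<in> edges G \<longleftrightarrow> {f u, f v} \<in> edges G'))"

definition contains_copy :: "'b ugraph \<Rightarrow> 'a ugraph \<Rightarrow> bool" where
  "contains_copy G H \<longleftrightarrow> (\<exists>F. is_subgraph F G \<and> graph_iso H F)"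

(* Every finite graph is isomorphic to one whose vertices are natural numbers.
   The set below is finite, and it is nonempty whenever H has an edge; for edgeless H with
   at most n vertices there is no H-free graph on n vertices and the value is unspecified. *)
definition ex :: "nat \<Rightarrow> 'a ugraph \<Rightarrow> nat" where
  "ex n H = Max {card (edges G) | G :: nat ugraph.
                   simple_graph G \<and> card (verts G) = n \<and> \<not> contains_copy G H}"

definition is_walk :: "'a ugraph \<Rightarrow> 'a list \<Rightarrow> bool" where
  "is_walk G xs \<longleftrightarrow>
     xs \<noteq> [] \<and> set xs \<subseteq> verts G \<and> successively (\<lambda>u v. {u, v} \<in> edges G) xs"

definition connected_graph :: "'a ugraph \<Rightarrow> bool" where
  "connected_graph G \<longleftrightarrow>
     verts G \<noteq> {} \<and>
     (\<forall>u\<in>verts G. \<forall>v\<in>verts G. \<exists>xs. is_walk G xs \<and> hd xs = u \<and> last xs = v)"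

definition bipartite_graph :: "'a ugraph \<Rightarrow> bool" where
  "bipartite_graph G \<longleftrightarrow>
     (\<exists>A B. A \<union> B = verts G \<and> A \<inter> B = {} \<and> (\<forall>e\<in>edges G. \<exists>a\<in>A. \<exists>b\<in>B. e = {a, b}))"

(* A cycle is listed by its vertices without repeating the first one at the end,
   so its length (number of edges) is the length of the list. *)
definition is_cycle :: "'a ugraph \<Rightarrow> 'a list \<Rightarrow> bool" where
  "is_cycle G c \<longleftrightarrow>
     length c \<ge> 3 \<and> distinct c \<and> is_walk G c \<and> {last c, hd c} \<in> edges G"

definition acyclic_graph :: "'a ugraph \<Rightarrow> bool" where
  "acyclic_graph G \<longleftrightarrow> (\<nexists>c. is_cycle G c)"

definition delete_verts :: "'a ugraph \<Rightarrow> 'a set \<Rightarrow> 'a ugraph" where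
  "delete_verts G S = \<lparr>verts = verts G - S, edges = {e \<in> edges G. e \<inter> S = {}}\<rparr>"

definition feedback_vertex_set :: "'a ugraph \<Rightarrow> 'a set \<Rightarrow> bool" where
  "feedback_vertex_set G S \<longleftrightarrow> S \<subseteq> verts G \<and> acyclic_graph (delete_verts G S)"

definition feedback_vertex_number :: "'a ugraph \<Rightarrow> nat" where
  "feedback_vertex_number G = Min {card S | S. feedback_vertex_set G S}"

(* Length of a shortest cycle; unspecified for acyclic G. *)
definition girth :: "'a ugraph \<Rightarrow> nat" where
  "girth G = Min {length c | c. is_cycle G c}"

end

theory Submission
  imports Defs
begin

text \<open>
  Fix a feedback vertex \<open>v\<close> of \<open>H\<close> and grade \<open>H\<close> by the distance from \<open>v\<close>. As \<open>H\<close> has no cycle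
  shorter than \<open>2k\<close>, for every \<open>l \<le> k\<close> the levels below \<open>l\<close> induce a tree, and \<open>H - v\<close> is a forest.
  So \<open>H\<close> embeds greedily into every host consisting of levels \<open>A 0 = {x}, A 1, \<dots>, A l\<close> with
  \<open>2 \<le> l \<le> k\<close> in which each vertex of \<open>A j\<close>, \<open>j < l\<close>, has many neighbours in \<open>A (j + 1)\<close> and each
  vertex of \<open>A l\<close> is joined to \<open>x\<close> by many internally disjoint paths through the levels: go up along
  the branching, oscillate between \<open>A l\<close> and \<open>A (l - 1)\<close>, and whenever the forest comes
  down towards \<open>v\<close> again, use a fresh path back to \<open>x\<close>.

  To find such a host in a graph on \<open>n\<close> vertices with minimum degree \<open>\<delta> \<ge> C n powr (1 / k)\<close>, weight
  walks by the stationary random walk; its reversibility replaces any assumption on the maximum degree.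
  A path is light if its proper subpaths are light and the weight of the competing paths with
  the same end points is small. The light paths of length \<open>k\<close> have total weight at most
  \<open>n\<^sup>2 threshold k\<close>, too little to account for almost all walks, so for some \<open>l \<le> k\<close> a positive
  proportion of all walks of length \<open>l\<close> is heavy with light proper subpaths. Among those starting at a
  suitable \<open>x\<close>, delete the paths through prefixes with few continuations and those whose end point is not
  reached by many disjoint paths. Few disjoint paths would put a small transversal on all of them,
  and lightness of the two pieces of a path bounds the weight through each vertex of it,
  so not everything is deleted.
\<close>

section \<open>Hosts inside graphs of large minimum degree\<close>

text \<open>The levels may overlap, and no vertex is asked to have many neighbours in a lower level;
  the only way down is along a path of \<open>F\<close>. Since \<open>A 0 = {x}\<close>, these paths
  all start at \<open>x\<close>. The single parameter \<open>D\<close> measures both the branching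
  and the number of paths; for an embedding it has to exceed the number of vertices to be
  placed.\<close>

definition level_host ::
  "('v \<Rightarrow> 'v \<Rightarrow> bool) \<Rightarrow> 'v \<Rightarrow> (nat \<Rightarrow> 'v set) \<Rightarrow> nat \<Rightarrow> nat \<Rightarrow> bool" where
  "level_host E x A l D \<longleftrightarrow> A 0 = {x} \<and>
     (\<forall>j<l. \<forall>y\<in>A j. D \<le> card {z \<in> A (Suc j). E y z}) \<and>
     (\<forall>z\<in>A l. \<exists>F. card F = D \<and>
        (\<forall>ys\<in>F. \<forall>zs\<in>F. ys \<noteq> zs \<longrightarrow> set (butlast (tl ys)) \<inter> set (butlast (tl zs)) = {}) \<and>
        (\<forall>ys\<in>F. length ys = Suc l \<and> distinct ys \<and> last ys = z \<and> successively E ys \<and>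
           (\<forall>i\<le>l. ys ! i \<in> A i)))"

locale dense_graph =
  fixes V :: "'v set" and E :: "'v \<Rightarrow> 'v \<Rightarrow> bool" and \<delta> K :: real
  assumes finite_V: "finite V"
    and V_nonempty: "V \<noteq> {}"
    and E_sym: "E u v \<Longrightarrow> E v u"
    and E_irrefl: "\<not> E u u"
    and E_in_V: "E u v \<Longrightarrow> u \<in> V"
    and min_degree: "v \<in> V \<Longrightarrow> \<delta> \<le> real (card {u. E v u})"
    and delta_ge_1: "1 \<le> \<delta>"
    and K_gt_1: "1 < K"
begin

definition nb :: "'v \<Rightarrow> 'v set" where "nb v = {u. E v u}"

definition inv_degree :: "'v \<Rightarrow> real" where "inv_degree v = 1 / real (card (nb v))"

definition walks :: "nat \<Rightarrow> 'v list set" where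
  "walks n = {xs. length xs = Suc n \<and> set xs \<subseteq> V \<and> successively E xs}"

text \<open>Up to the factor \<open>1 / vol\<close> this is the probability of the walk \<open>xs\<close> under the stationary
  random walk. Only the inner vertices count, so it is invariant under reversal.\<close>

definition wt :: "'v list \<Rightarrow> real" where
  "wt xs = prod_list (map inv_degree (butlast (tl xs)))"

abbreviation weight :: "'v list set \<Rightarrow> real" where
  "weight A \<equiv> sum wt A"

definition vol :: real where "vol = (\<Sum>v\<in>V. real (card (nb v)))"

text \<open>The exponents are chosen such that the identity \<open>threshold_mult\<close> holds.\<close>

definition threshold :: "nat \<Rightarrow> real" where
  "threshold n = K ^ (2 * n - 1) / \<delta> ^ (n - 1)"

definition extend :: "nat \<Rightarrow> 'v list set \<Rightarrow> 'v list set" where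
  "extend n L = {xs \<in> walks (Suc n). distinct xs \<and> butlast xs \<in> L \<and> tl xs \<in> L}"

text \<open>The competitors of \<open>xs\<close> are all paths of \<open>extend n (light n)\<close>
  with its end points, whether or not they turn out to be light. So for given ends either all of
  them are light or all are heavy, and a heavy class weighs at least the threshold.\<close>

primrec light :: "nat \<Rightarrow> 'v list set" where
  "light 0 = walks 0"
| "light (Suc n) = {xs \<in> extend n (light n).
     weight {ys \<in> extend n (light n). hd ys = hd xs \<and> last ys = last xs} < threshold (Suc n)}"

text \<open>Only meaningful for \<open>n \<ge> 1\<close>: \<open>admissible 0\<close> consists of paths of length 1.\<close>

abbreviation admissible :: "nat \<Rightarrow> 'v list set" where
  "admissible n \<equiv> extend (n - 1) (light (n - 1))"

definition heavy :: "nat \<Rightarrow> 'v list set" where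
  "heavy n = admissible n - light n"

section \<open>Walks and their weights under the stationary random walk\<close>

lemma finite_nb [simp]: "finite (nb v)"
  unfolding nb_def by (rule finite_subset[OF _ finite_V]) (auto intro: E_in_V E_sym)

lemma nb_subset: "nb v \<subseteq> V"
  unfolding nb_def by (auto intro: E_in_V E_sym)

lemma inv_degree_nonneg [simp]: "0 \<le> inv_degree v"
  by (simp add: inv_degree_def)

lemma card_nb: "v \<in> V \<Longrightarrow> \<delta> \<le> real (card (nb v))"
  using min_degree by (simp add: nb_def)

lemma inv_degree_le: "v \<in> V \<Longrightarrow> inv_degree v \<le> 1 / \<delta>"
  using card_nb[of v] delta_ge_1 by (simp add: inv_degree_def frac_le)

lemma card_nb_inv_degree: "v \<in> V \<Longrightarrow> real (card (nb v)) * inv_degree v = 1"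
  using card_nb[of v] delta_ge_1 by (auto simp: inv_degree_def)

lemma finite_walks [simp]: "finite (walks n)"
  by (rule finite_subset[OF _ finite_lists_length_eq[OF finite_V, of "Suc n"]])
     (auto simp: walks_def)

lemma wt_nonneg [simp]: "0 \<le> wt xs"
  unfolding wt_def by (rule prod_list_nonneg) auto

lemma weight_mono: "A \<subseteq> B \<Longrightarrow> B \<subseteq> walks n \<Longrightarrow> weight A \<le> weight B"
  by (rule sum_mono2) (auto intro: finite_subset[OF _ finite_walks])

lemma weight_nonneg [simp]: "0 \<le> weight A"
  by (rule sum_nonneg) auto

lemma wt_snoc:
  assumes "2 \<le> length xs"
  shows "wt (xs @ [y]) = wt xs * inv_degree (last xs)"
proof -
  obtain a b zs where xs: "xs = a # zs @ [b]"
    using assms by (cases xs; cases "tl xs" rule: rev_cases) auto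
  show ?thesis by (simp add: xs wt_def butlast_append)
qed

lemma wt_split:
  assumes "as \<noteq> []" "bs \<noteq> []"
  shows "wt (as @ y # bs) = wt (as @ [y]) * inv_degree y * wt (y # bs)"
  using assms by (cases as) (auto simp: wt_def butlast_append)

lemma walk_snoc_iff:
  assumes "length xs = Suc n"
  shows "xs @ [y] \<in> walks (Suc n) \<longleftrightarrow> xs \<in> walks n \<and> y \<in> nb (last xs)"
  using assms nb_subset
  by (cases xs rule: rev_cases) (auto simp: walks_def successively_append_iff nb_def)

lemma walks_lengthD: "xs \<in> walks n \<Longrightarrow> length xs = Suc n"
  by (simp add: walks_def)

lemma walks_last_in: "xs \<in> walks n \<Longrightarrow> last xs \<in> V"
  by (cases xs rule: rev_cases) (auto simp: walks_def)

lemma walks_hd_in: "xs \<in> walks n \<Longrightarrow> hd xs \<in> V"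
  by (cases xs) (auto simp: walks_def)

lemma walk_butlast:
  assumes "ys \<in> walks (Suc n)"
  shows "butlast ys \<in> walks n" "last ys \<in> nb (last (butlast ys))"
proof -
  have "length (butlast ys) = Suc n" "ys = butlast ys @ [last ys]"
    using walks_lengthD[OF assms] by (auto intro: append_butlast_last_id[symmetric])
  then show "butlast ys \<in> walks n" "last ys \<in> nb (last (butlast ys))"
    using assms walk_snoc_iff by metis+
qed

text \<open>Each \<open>xs\<close> in \<open>A\<close> has \<open>card (B xs)\<close> prolongations,
  and each of them costs the factor \<open>inv_degree (last xs)\<close>. The set \<open>B\<close> is
  general because it serves once with all neighbours and once with those already visited.\<close>

lemma weight_extend_right_gen:
  assumes A: "A \<subseteq> walks n" and n: "1 \<le> n" and B: "\<And>xs. xs \<in> A \<Longrightarrow> B xs \<subseteq> nb (last xs)"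
  shows "weight {ys \<in> walks (Suc n). butlast ys \<in> A \<and> last ys \<in> B (butlast ys)}
       = (\<Sum>xs\<in>A. real (card (B xs)) * (wt xs * inv_degree (last xs)))"
proof -
  have fA: "finite A" using A finite_subset finite_walks by blast
  have fB: "finite (B xs)" if "xs \<in> A" for xs
    using B[OF that] finite_subset finite_nb by blast
  have len: "length xs = Suc n" if "xs \<in> A" for xs
    using A that walks_lengthD by blast
  have inj: "inj_on (\<lambda>(xs, y). xs @ [y]) (Sigma A B)"
    by (auto simp: inj_on_def)
  have img: "{ys \<in> walks (Suc n). butlast ys \<in> A \<and> last ys \<in> B (butlast ys)}
      = (\<lambda>(xs, y). xs @ [y]) ` Sigma A B" (is "?L = ?R")
  proof
    show "?L \<subseteq> ?R"
    proof
      fix ys assume ys: "ys \<in> ?L"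
      then have "ys \<noteq> []" by (auto simp: walks_def)
      then have "ys = butlast ys @ [last ys]" by simp
      then show "ys \<in> ?R" using ys by (force simp: image_iff)
    qed
    show "?R \<subseteq> ?L"
      using A B by (fastforce simp: walk_snoc_iff len)
  qed
  have "weight ?L = (\<Sum>(xs, y)\<in>Sigma A B. wt (xs @ [y]))"
    unfolding img by (subst sum.reindex[OF inj]) (simp add: case_prod_unfold)
  also have "\<dots> = (\<Sum>xs\<in>A. \<Sum>y\<in>B xs. wt (xs @ [y]))"
    by (subst sum.Sigma) (use fA fB in auto)
  also have "\<dots> = (\<Sum>xs\<in>A. \<Sum>y\<in>B xs. wt xs * inv_degree (last xs))"
    by (intro sum.cong refl wt_snoc) (use len n in auto)
  finally show ?thesis by simp
qed

text \<open>The prolongations of a walk share its weight equally: there are as many as the degree of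
  its last vertex. This is conservation of probability in one step of the random walk.\<close>

lemma weight_extend_right:
  assumes A: "A \<subseteq> walks n" and n: "1 \<le> n"
  shows "weight {ys \<in> walks (Suc n). butlast ys \<in> A} = weight A"
proof -
  have "{ys \<in> walks (Suc n). butlast ys \<in> A}
      = {ys \<in> walks (Suc n). butlast ys \<in> A \<and> last ys \<in> nb (last (butlast ys))}"
    using walk_butlast(2) by blast
  also have "weight \<dots> = (\<Sum>xs\<in>A. real (card (nb (last xs))) * (wt xs * inv_degree (last xs)))"
    by (rule weight_extend_right_gen[OF A n]) simp
  also have "\<dots> = weight A"
  proof (rule sum.cong[OF refl])
    fix xs assume "xs \<in> A"
    then have "last xs \<in> V" using A walks_last_in by blast
    from card_nb_inv_degree[OF this] show "real (card (nb (last xs))) * (wt xs * inv_degree (last xs)) = wt xs"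
      by (metis mult.left_commute mult.right_neutral)
  qed
  finally show ?thesis .
qed

lemma wt_rev: "wt (rev xs) = wt xs"
proof -
  have "tl (rev xs) = rev (butlast xs)" by (metis butlast_rev rev_rev_ident)
  then have "butlast (tl (rev xs)) = rev (tl (butlast xs))" by (simp add: butlast_rev)
  also have "tl (butlast xs) = butlast (tl xs)" by (metis butlast_tl)
  finally show ?thesis by (simp add: wt_def rev_map[symmetric])
qed

lemma rev_walk: "rev xs \<in> walks n \<longleftrightarrow> xs \<in> walks n"
proof -
  have "successively E (rev xs) = successively E xs"
    by (simp add: successively_rev) (metis E_sym successively_mono)
  then show ?thesis by (simp add: walks_def)
qed

text \<open>Reversal preserves both walks and weights, so \<open>weight_extend_right\<close> applies
  to the reversed walks.\<close>

lemma weight_extend_left: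
  assumes A: "A \<subseteq> walks n" and n: "1 \<le> n"
  shows "weight {ys \<in> walks (Suc n). tl ys \<in> A} = weight A"
proof -
  have inj: "inj_on rev B" for B :: "'v list set" by (auto simp: inj_on_def)
  have w: "weight (rev ` B) = weight B" for B
    by (subst sum.reindex[OF inj]) (simp add: wt_rev)
  have "rev ` {ys \<in> walks (Suc n). tl ys \<in> A} = {ys \<in> walks (Suc n). butlast ys \<in> rev ` A}"
    (is "?L = ?R")
  proof
    show "?L \<subseteq> ?R" by (auto simp: rev_walk butlast_rev)
    show "?R \<subseteq> ?L"
    proof
      fix ys assume ys: "ys \<in> ?R"
      then obtain zs where "zs \<in> A" "butlast ys = rev zs" by auto
      then have "tl (rev ys) \<in> A" by (metis butlast_rev rev_rev_ident)
      moreover have "rev ys \<in> walks (Suc n)" using ys by (simp add: rev_walk)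
      ultimately have "rev ys \<in> {ys \<in> walks (Suc n). tl ys \<in> A}" by simp
      then show "ys \<in> ?L" by (rule image_eqI[rotated]) simp
    qed
  qed
  then have "weight {ys \<in> walks (Suc n). tl ys \<in> A} = weight {ys \<in> walks (Suc n). butlast ys \<in> rev ` A}"
    using w[of "{ys \<in> walks (Suc n). tl ys \<in> A}"] by simp
  also have "\<dots> = weight (rev ` A)"
    by (rule weight_extend_right[OF _ n]) (use A in \<open>auto simp: rev_walk\<close>)
  finally show ?thesis by (simp add: w)
qed

lemma walks_1_eq: "walks 1 = (\<lambda>(a, b). [a, b]) ` Sigma V nb"
  by (auto simp: walks_def length_Suc_conv nb_def image_iff intro: E_in_V E_in_V[OF E_sym])

lemma weight_walks_from:
  assumes "1 \<le> n" "x \<in> V"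
  shows "weight {xs \<in> walks n. hd xs = x} = real (card (nb x))"
  using assms(1)
proof (induction n rule: dec_induct)
  case base
  have eq: "{xs \<in> walks 1. hd xs = x} = (\<lambda>y. [x, y]) ` nb x"
    using assms(2) unfolding walks_1_eq by auto
  have "weight {xs \<in> walks 1. hd xs = x} = (\<Sum>y\<in>nb x. wt [x, y])"
    unfolding eq by (subst sum.reindex) (auto simp: inj_on_def)
  then show ?case by (simp add: wt_def)
next
  case (step n)
  have "hd (butlast ys) = hd ys" if "ys \<in> walks (Suc n)" for ys
    using that step(1) by (cases ys) (auto simp: walks_def)
  then have "{xs \<in> walks (Suc n). hd xs = x}
      = {xs \<in> walks (Suc n). butlast xs \<in> {xs \<in> walks n. hd xs = x}}"
    using walk_butlast(1) by auto
  then show ?case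
    using weight_extend_right[of "{xs \<in> walks n. hd xs = x}" n] step by simp
qed

lemma weight_Un_le:
  assumes "finite A" "finite B"
  shows "weight (A \<union> B) \<le> weight A + weight B"
  using sum.union_inter[OF assms, of wt] weight_nonneg[of "A \<inter> B"] by linarith

lemma weight_UN_le:
  assumes "finite I" "\<And>i. i \<in> I \<Longrightarrow> finite (A i)"
  shows "weight (\<Union>i\<in>I. A i) \<le> (\<Sum>i\<in>I. weight (A i))"
  using assms
proof (induction I rule: finite_induct)
  case empty
  then show ?case by simp
next
  case (insert i I)
  have "weight (A i \<union> (\<Union>i\<in>I. A i)) \<le> weight (A i) + weight (\<Union>i\<in>I. A i)"
    using insert by (intro weight_Un_le) auto
  then show ?case using insert by simp
qed

lemma weight_by_hd:
  assumes "A \<subseteq> walks n"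
  shows "weight A = (\<Sum>x\<in>V. weight {xs \<in> A. hd xs = x})"
proof (rule sum.group[symmetric])
  show "finite A" using assms finite_subset finite_walks by blast
  show "hd ` A \<subseteq> V" using assms walks_hd_in by blast
qed (rule finite_V)

lemma weight_walks:
  assumes "1 \<le> n"
  shows "weight (walks n) = vol"
  unfolding vol_def weight_by_hd[OF order_refl]
  by (rule sum.cong) (use weight_walks_from assms in auto)

lemma vol_ge: "\<delta> * real (card V) \<le> vol"
  unfolding vol_def using sum_mono[of V "\<lambda>_. \<delta>"] card_nb by (simp add: mult.commute)

lemma vol_pos: "0 < vol"
proof -
  have "0 < \<delta> * real (card V)"
    using delta_ge_1 V_nonempty finite_V by (simp add: card_gt_0_iff)
  then show ?thesis using vol_ge by linarith
qed

section \<open>Thresholds and light paths\<close>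

lemma threshold_pos: "0 < threshold n"
  using delta_ge_1 K_gt_1 by (simp add: threshold_def)

lemma threshold_mult:
  assumes "1 \<le> i" "1 \<le> j"
  shows "K * (threshold i * (1 / \<delta>) * threshold j) = threshold (i + j)"
proof -
  obtain a b where ab: "i = Suc a" "j = Suc b"
    using assms by (cases i; cases j) auto
  have exps: "2 * i - 1 = 2 * a + 1" "2 * j - 1 = 2 * b + 1" "i - 1 = a" "j - 1 = b"
    "2 * (i + j) - 1 = Suc (2 * a + 1 + (2 * b + 1))" "i + j - 1 = a + b + 1"
    using ab by simp_all
  show ?thesis
    unfolding threshold_def exps by (simp add: power_add mult_ac)
qed

lemma extend_subset: "extend n L \<subseteq> walks (Suc n)"
  by (auto simp: extend_def)

lemma light_subset: "light n \<subseteq> walks n"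
  by (cases n) (auto simp: extend_def)

lemma admissible_subset: "1 \<le> n \<Longrightarrow> admissible n \<subseteq> walks n"
  by (cases n) (auto simp: extend_def)

lemma light_distinct: "xs \<in> light n \<Longrightarrow> distinct xs"
  by (cases n) (auto simp: extend_def walks_def length_Suc_conv)

text \<open>A single light member with these end points bounds the weight of all its competitors;
  without such a member the weight is \<open>0\<close>.\<close>

lemma light_class:
  assumes "1 \<le> n"
  shows "weight {ys \<in> light n. hd ys = a \<and> last ys = b} \<le> threshold n"
proof (cases "{ys \<in> light n. hd ys = a \<and> last ys = b} = {}")
  case True
  show ?thesis unfolding True using threshold_pos[of n] by simp
next
  case False
  then obtain xs where xs: "xs \<in> light n" "hd xs = a" "last xs = b" by auto
  obtain n' where n: "n = Suc n'" using assms by (cases n) auto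
  have "weight {ys \<in> light n. hd ys = a \<and> last ys = b}
      \<le> weight {ys \<in> extend n' (light n'). hd ys = a \<and> last ys = b}"
    by (rule weight_mono[of _ _ n]) (auto simp: n extend_def)
  also have "\<dots> < threshold n" using xs by (auto simp: n)
  finally show ?thesis by simp
qed

text \<open>A walk of length 1 is its own only competitor, and its weight is the empty product
  \<open>1\<close>, below \<open>threshold 1 = K\<close>. So heavy paths can occur only from length
  2 on.\<close>

lemma light_1: "light 1 = walks 1"
proof -
  have e: "extend 0 (light 0) = walks 1"
    unfolding extend_def
    by (auto simp: walks_def length_Suc_conv E_irrefl)
  have "weight {ys \<in> walks 1. hd ys = hd xs \<and> last ys = last xs} < threshold 1"
    if "xs \<in> walks 1" for xs
  proof -
    have "{ys \<in> walks 1. hd ys = hd xs \<and> last ys = last xs} = {xs}"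
      using that by (auto simp: walks_def length_Suc_conv)
    moreover have "wt xs = 1" using that by (auto simp: walks_def length_Suc_conv wt_def)
    ultimately show ?thesis using K_gt_1 by (simp add: threshold_def)
  qed
  then show ?thesis using e by auto
qed

lemma light_take: "xs \<in> light n \<Longrightarrow> i \<le> n \<Longrightarrow> take (Suc i) xs \<in> light i"
proof (induction n arbitrary: xs)
  case 0
  then show ?case by (simp add: walks_lengthD)
next
  case (Suc n)
  show ?case
  proof (cases "i = Suc n")
    case True
    then show ?thesis using Suc.prems light_subset walks_lengthD by (metis order_refl subsetD take_all)
  next
    case False
    then have i: "i \<le> n" using Suc.prems by simp
    have "butlast xs \<in> light n" "length xs = Suc (Suc n)"
      using Suc.prems by (auto simp: extend_def walks_lengthD)
    then show ?thesis
      using Suc.IH[of "butlast xs"] i by (simp add: take_butlast)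
  qed
qed

lemma light_drop: "xs \<in> light n \<Longrightarrow> i \<le> n \<Longrightarrow> drop i xs \<in> light (n - i)"
proof (induction n arbitrary: xs i)
  case 0
  then show ?case by simp
next
  case (Suc n)
  show ?case
  proof (cases i)
    case 0
    then show ?thesis using Suc.prems by simp
  next
    case (Suc j)
    then have i: "j \<le> n" using Suc.prems by simp
    have "tl xs \<in> light n"
      using Suc.prems by (auto simp: extend_def)
    then show ?thesis
      using Suc.IH[of "tl xs" j] i Suc by (simp add: drop_Suc)
  qed
qed

lemma admissible_take:
  assumes "xs \<in> admissible n" "i < n"
  shows "take (Suc i) xs \<in> light i"
proof -
  have "butlast xs \<in> light (n - 1)" "length xs = Suc n"
    using assms by (auto simp: extend_def walks_lengthD)
  then show ?thesis using light_take[of "butlast xs" "n - 1" i] assms(2) by (simp add: take_butlast)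
qed

lemma admissible_drop:
  assumes "xs \<in> admissible n" "0 < i" "i < n"
  shows "drop i xs \<in> light (n - i)"
proof -
  have "tl xs \<in> light (n - 1)"
    using assms by (auto simp: extend_def)
  from light_drop[OF this, of "i - 1"] show ?thesis
    using assms(2,3) by (cases i) (auto simp: drop_Suc)
qed

text \<open>Prolonging light paths to the right keeps their weight. A prolongation fails to be
  admissible only if its tail is not light, of weight \<open>vol - weight (light n)\<close> by left
  extension, or if its last vertex repeats one of at most \<open>n + 1\<close> earlier vertices,
  each repetition costing a factor of at most \<open>1 / \<delta>\<close>.\<close>

lemma weight_extend:
  assumes n: "1 \<le> n"
  shows "2 * weight (light n) - vol - (real n + 1) / \<delta> * vol \<le> weight (extend n (light n))"
proof -
  let ?W = "walks (Suc n)"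
  let ?A = "{ys \<in> ?W. butlast ys \<in> light n}"
  let ?B = "{ys \<in> ?W. tl ys \<in> walks n - light n}"
  let ?C = "{ys \<in> ?W. butlast ys \<in> light n \<and> last ys \<in> set (butlast ys) \<inter> nb (last (butlast ys))}"
  have cover: "?A \<subseteq> extend n (light n) \<union> (?B \<union> ?C)"
  proof
    fix ys assume ys: "ys \<in> ?A"
    obtain zs z where zs: "ys = zs @ [z]" using ys by (cases ys rule: rev_cases) (auto simp: walks_def)
    have "tl ys \<in> walks n"
    proof -
      have "rev (tl ys) = butlast (rev ys)" by (simp add: butlast_rev)
      moreover have "butlast (rev ys) \<in> walks n" using ys by (intro walk_butlast(1)) (simp add: rev_walk)
      ultimately show ?thesis using rev_walk by metis
    qed
    moreover have "z \<in> nb (last zs)" "distinct zs"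
      using ys light_distinct walk_butlast(2)[of ys n] by (auto simp: zs)
    ultimately show "ys \<in> extend n (light n) \<union> (?B \<union> ?C)"
      using ys by (auto simp: extend_def zs)
  qed
  have fin: "finite (extend n (light n))" "finite ?B" "finite ?C"
    using extend_subset finite_walks finite_subset by (blast, auto)
  have A: "weight ?A = weight (light n)"
    by (rule weight_extend_right[OF light_subset n])
  have B: "weight ?B = vol - weight (light n)"
    using weight_extend_left[of "walks n - light n" n] n
    by (simp add: sum_diff light_subset weight_walks)
  have "weight ?C = (\<Sum>xs\<in>light n. real (card (set xs \<inter> nb (last xs))) * (wt xs * inv_degree (last xs)))"
    by (rule weight_extend_right_gen[OF light_subset n]) simp
  also have "\<dots> \<le> (\<Sum>xs\<in>light n. (real n + 1) / \<delta> * wt xs)"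
  proof (rule sum_mono)
    fix xs assume xs: "xs \<in> light n"
    then have w: "xs \<in> walks n" using light_subset by blast
    have "card (set xs \<inter> nb (last xs)) \<le> card (set xs)" by (intro card_mono) auto
    also have "\<dots> \<le> Suc n" using card_length[of xs] walks_lengthD[OF w] by simp
    finally have "real (card (set xs \<inter> nb (last xs))) * (wt xs * inv_degree (last xs))
       \<le> (real n + 1) * (wt xs * (1 / \<delta>))"
      using inv_degree_le[OF walks_last_in[OF w]] by (intro mult_mono) auto
    then show "real (card (set xs \<inter> nb (last xs))) * (wt xs * inv_degree (last xs)) \<le> (real n + 1) / \<delta> * wt xs"
      by (simp add: field_simps)
  qed
  also have "\<dots> = (real n + 1) / \<delta> * weight (light n)" by (simp add: sum_distrib_left)
  also have "\<dots> \<le> (real n + 1) / \<delta> * vol"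
    using weight_mono[OF light_subset[of n] order_refl] weight_walks[OF n] delta_ge_1
    by (intro mult_left_mono) auto
  finally have C: "weight ?C \<le> (real n + 1) / \<delta> * vol" .
  have "weight ?A \<le> weight (extend n (light n) \<union> (?B \<union> ?C))"
    by (rule sum_mono2[OF _ cover]) (use fin in auto)
  also have "\<dots> \<le> weight (extend n (light n)) + weight (?B \<union> ?C)"
    using fin by (intro weight_Un_le) auto
  also have "weight (?B \<union> ?C) \<le> weight ?B + weight ?C"
    using fin by (intro weight_Un_le) auto
  finally show ?thesis using A B C by linarith
qed

lemma weight_light_le:
  assumes "1 \<le> n"
  shows "weight (light n) \<le> real (card V) ^ 2 * threshold n"
proof -
  have "weight (light n) = (\<Sum>p\<in>V \<times> V. weight {xs \<in> light n. (hd xs, last xs) = p})"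
  proof (rule sum.group[symmetric])
    show "finite (light n)" using light_subset finite_subset finite_walks by blast
    show "finite (V \<times> V)" using finite_V by simp
    show "(\<lambda>xs. (hd xs, last xs)) ` light n \<subseteq> V \<times> V"
      using light_subset walks_hd_in walks_last_in by blast
  qed
  also have "\<dots> \<le> (\<Sum>p\<in>V \<times> V. threshold n)"
  proof (rule sum_mono)
    fix p :: "'v \<times> 'v" assume "p \<in> V \<times> V"
    have "{xs \<in> light n. (hd xs, last xs) = p} = {xs \<in> light n. hd xs = fst p \<and> last xs = snd p}" by auto
    then show "weight {xs \<in> light n. (hd xs, last xs) = p} \<le> threshold n"
      using light_class[OF assms] by simp
  qed
  finally show ?thesis by (simp add: card_cartesian_product power2_eq_square)
qed

text \<open>If all heavy classes were small, the deficit \<open>vol - weight (light n)\<close> would at most double in each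
  step, up to a small error.\<close>

lemma heavy_length_exists:
  assumes k: "1 \<le> k" and eps: "0 < \<epsilon>" and big: "\<delta> ^ k > 2 * K ^ (2 * k - 1) * real (card V)"
    and small: "2 ^ k * (\<epsilon> + (real k + 1) / \<delta>) \<le> 1 / 2"
  shows "\<exists>l. 2 \<le> l \<and> l \<le> k \<and> \<epsilon> * vol \<le> weight (heavy l)"
proof (rule ccontr)
  assume "\<not> ?thesis"
  then have no: "weight (heavy l) < \<epsilon> * vol" if "2 \<le> l" "l \<le> k" for l
    using that by (meson not_le)
  let ?\<eta> = "\<epsilon> + (real k + 1) / \<delta>"
  have eta: "0 \<le> ?\<eta>" using eps delta_ge_1 by simp
  \<comment> \<open>Writing \<open>d n = 1 - weight (light n) / vol\<close>, the assumption gives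
    \<open>d (n + 1) \<le> 2 * d n + ?\<eta>\<close> with \<open>d 1 = 0\<close>, which keeps
    \<open>d n\<close> below \<open>(2 ^ n - 1) * ?\<eta>\<close>.\<close>
  have "vol * (1 - (2 ^ n - 1) * ?\<eta>) \<le> weight (light n)" if "1 \<le> n" "n \<le> k" for n
    using that
  proof (induction n rule: dec_induct)
    case base
    have "vol * (1 - (2 ^ 1 - 1) * ?\<eta>) \<le> vol * 1"
      using vol_pos eta by (intro mult_left_mono) auto
    then show ?case using weight_walks[of 1] light_1 by simp
  next
    case (step n)
    have "light (Suc n) \<subseteq> extend n (light n)" by auto
    then have "weight (extend n (light n)) = weight (light (Suc n)) + weight (heavy (Suc n))"
      unfolding heavy_def
      by (subst sum_diff) (auto intro: finite_subset[OF extend_subset finite_walks])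
    then have "weight (light (Suc n)) \<ge> weight (extend n (light n)) - \<epsilon> * vol"
      using no[of "Suc n"] step by simp
    moreover note weight_extend[OF step(1)]
    moreover have "(real n + 1) / \<delta> * vol \<le> (real k + 1) / \<delta> * vol"
      using step vol_pos delta_ge_1 by (intro mult_right_mono divide_right_mono) auto
    moreover have "vol * (1 - (2 ^ n - 1) * ?\<eta>) \<le> weight (light n)" using step by simp
    ultimately have "2 * (vol * (1 - (2 ^ n - 1) * ?\<eta>)) - vol - (real k + 1) / \<delta> * vol - \<epsilon> * vol \<le> weight (light (Suc n))"
      by linarith
    moreover have "2 * (vol * (1 - (2 ^ n - 1) * ?\<eta>)) - vol - (real k + 1) / \<delta> * vol - \<epsilon> * vol
      = vol * (1 - (2 ^ Suc n - 1) * ?\<eta>)"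
      by (simp add: algebra_simps)
    ultimately show ?case by simp
  qed
  from this[OF k order_refl] have 1: "vol * (1 - (2 ^ k - 1) * ?\<eta>) \<le> weight (light k)" .
  have "(2 ^ k - 1) * ?\<eta> \<le> 2 ^ k * ?\<eta>" using eta by (intro mult_right_mono) auto
  then have "vol * (1 / 2) \<le> vol * (1 - (2 ^ k - 1) * ?\<eta>)"
    using order_trans[OF _ small] vol_pos by (intro mult_left_mono) auto
  also note 1
  also note weight_light_le[OF k]
  \<comment> \<open>Light paths of length \<open>k\<close> would carry half of \<open>vol\<close>,
    hence at least \<open>\<delta> * card V / 2\<close>; against the bound from counting end points
    this forces \<open>\<delta> ^ k\<close> into the range excluded by \<open>big\<close>.\<close>
  finally have "\<delta> * real (card V) \<le> 2 * real (card V) ^ 2 * threshold k"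
    using vol_ge by linarith
  moreover have cV: "0 < real (card V)" using V_nonempty finite_V by (simp add: card_gt_0_iff)
  ultimately have "\<delta> \<le> 2 * real (card V) * threshold k"
    by (simp add: power2_eq_square mult.assoc)
  moreover have "threshold k * \<delta> ^ k = K ^ (2 * k - 1) * \<delta>"
    using k delta_ge_1 by (cases k) (auto simp: threshold_def)
  ultimately have "\<delta> * \<delta> ^ k \<le> \<delta> * (2 * real (card V) * K ^ (2 * k - 1))"
    using mult_right_mono[of \<delta> "2 * real (card V) * threshold k" "\<delta> ^ k"] delta_ge_1
    by (simp add: mult_ac)
  then have "\<delta> ^ k \<le> 2 * real (card V) * K ^ (2 * k - 1)"
    using delta_ge_1 by simp
  then show False using big by (simp add: algebra_simps)
qed

section \<open>Walks with a prescribed prefix\<close>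

lemma weight_prefix:
  assumes r: "r \<in> walks j" and j: "1 \<le> j" "j \<le> l"
  shows "weight {xs \<in> walks l. take (Suc j) xs = r} = wt r"
  using j(2)
proof (induction l rule: dec_induct)
  case base
  have "{xs \<in> walks j. take (Suc j) xs = r} = {r}"
    using r by (auto simp: walks_lengthD)
  then show ?case by simp
next
  case (step l)
  have "take (Suc j) (butlast xs) = take (Suc j) xs" if "xs \<in> walks (Suc l)" for xs
    using walks_lengthD[OF that] step by (simp add: take_butlast)
  then have "{xs \<in> walks (Suc l). take (Suc j) xs = r}
     = {xs \<in> walks (Suc l). butlast xs \<in> {xs \<in> walks l. take (Suc j) xs = r}}"
    using walk_butlast(1) by auto
  then show ?case
    using weight_extend_right[of "{xs \<in> walks l. take (Suc j) xs = r}" l] step j by simp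
qed

text \<open>The weight of a nonempty \<open>p\<close> followed by one more vertex, whichever it is.
  By \<open>weight_prefix\<close> it is also the weight of all longer walks through one given
  continuation of \<open>p\<close>, so a prefix with at most \<open>D\<close> continuations carries
  at most \<open>D * prefix_cost p\<close>.\<close>

definition prefix_cost :: "'v list \<Rightarrow> real" where
  "prefix_cost p = prod_list (map inv_degree (tl p))"

lemma prefix_cost_nonneg [simp]: "0 \<le> prefix_cost p"
  unfolding prefix_cost_def by (rule prod_list_nonneg) auto

lemma wt_snoc_cost: "p \<noteq> [] \<Longrightarrow> wt (p @ [y]) = prefix_cost p"
  by (simp add: wt_def prefix_cost_def)

text \<open>For \<open>i \<ge> 1\<close> the cost is the weight times \<open>inv_degree\<close> of
  the last vertex, which is at most \<open>1 / \<delta>\<close>, and the weights add up to the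
  degree of \<open>x\<close>. For \<open>i = 0\<close> the single cost is \<open>1\<close>, covered
  by the minimum degree.\<close>

lemma sum_prefix_cost:
  assumes x: "x \<in> V"
  shows "sum prefix_cost {p \<in> walks i. hd p = x} \<le> real (card (nb x)) / \<delta>"
proof (cases i)
  case 0
  have "{p \<in> walks i. hd p = x} = {[x]}"
    using x by (auto simp: 0 walks_def length_Suc_conv)
  then show ?thesis using card_nb[OF x] delta_ge_1 by (simp add: prefix_cost_def)
next
  case (Suc n)
  have "sum prefix_cost {p \<in> walks i. hd p = x} \<le> (\<Sum>p\<in>{p \<in> walks i. hd p = x}. wt p * (1 / \<delta>))"
  proof (rule sum_mono)
    fix p assume "p \<in> {p \<in> walks i. hd p = x}"
    then have p: "p \<in> walks i" by simp
    have "wt (p @ [x]) = wt p * inv_degree (last p)"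
      using walks_lengthD[OF p] Suc by (intro wt_snoc) simp
    moreover have "p \<noteq> []" using walks_lengthD[OF p] by auto
    ultimately have "prefix_cost p = wt p * inv_degree (last p)" using wt_snoc_cost by metis
    also have "\<dots> \<le> wt p * (1 / \<delta>)"
      by (intro mult_left_mono inv_degree_le walks_last_in[OF p]) simp
    finally show "prefix_cost p \<le> wt p * (1 / \<delta>)" .
  qed
  also have "\<dots> = real (card (nb x)) / \<delta>"
    using weight_walks_from[of i x] x Suc by (simp add: sum_divide_distrib[symmetric])
  finally show ?thesis .
qed

text \<open>Cut each path at position \<open>i\<close>: both pieces are light as proper subpaths,
  and the weight is multiplicative up to the factor \<open>inv_degree y\<close>. The two class
  bounds multiply to \<open>threshold l / K\<close> by \<open>threshold_mult\<close>; the gain of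
  \<open>K\<close> is what makes transversals expensive.\<close>

lemma weight_through:
  assumes l: "0 < i" "i < l" and x: "x \<in> V" and y: "y \<in> V"
  shows "weight {xs \<in> admissible l. hd xs = x \<and> last xs = z \<and> xs ! i = y} \<le> threshold l / K"
proof -
  let ?A = "{xs \<in> admissible l. hd xs = x \<and> last xs = z \<and> xs ! i = y}"
  let ?L = "{as \<in> light i. hd as = x \<and> last as = y}"
  let ?R = "{bs \<in> light (l - i). hd bs = y \<and> last bs = z}"
  let ?g = "\<lambda>xs. (take (Suc i) xs, drop i xs)"
  have fin: "finite ?L" "finite ?R"
    using finite_subset[OF light_subset finite_walks] by auto
  have len: "length xs = Suc l" if "xs \<in> ?A" for xs
    using that admissible_subset[of l] l walks_lengthD by auto
  have inj: "inj_on ?g ?A"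
  proof (rule inj_onI)
    fix xs ys assume eq: "?g xs = ?g ys"
    then have "take i (take (Suc i) xs) = take i (take (Suc i) ys)" by simp
    then have "take i xs = take i ys" by (simp add: min_def)
    moreover have "drop i xs = drop i ys" using eq by simp
    ultimately show "xs = ys" by (metis append_take_drop_id)
  qed
  have img: "?g ` ?A \<subseteq> ?L \<times> ?R"
  proof
    fix p assume "p \<in> ?g ` ?A"
    then obtain xs where xs: "xs \<in> ?A" "p = ?g xs" by auto
    have "take (Suc i) xs \<in> light i" "drop i xs \<in> light (l - i)"
      using xs l by (auto intro!: admissible_take admissible_drop)
    moreover have "hd (take (Suc i) xs) = x" "last (drop i xs) = z" "hd (drop i xs) = y"
      using xs(1) len[OF xs(1)] l by (auto simp: hd_drop_conv_nth)
    moreover have "last (take (Suc i) xs) = y"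
      using xs(1) len[OF xs(1)] l by (simp add: take_Suc_conv_app_nth)
    ultimately show "p \<in> ?L \<times> ?R" using xs by auto
  qed
  have wt_eq: "wt xs = wt (take (Suc i) xs) * inv_degree y * wt (drop i xs)" if xs: "xs \<in> ?A" for xs
  proof -
    have y': "xs ! i = y" using xs by simp
    have t: "take (Suc i) xs = take i xs @ [y]" "drop i xs = y # drop (Suc i) xs"
      using len[OF xs] l y' take_Suc_conv_app_nth[of i xs] Cons_nth_drop_Suc[of i xs] by auto
    have "wt xs = wt (take i xs @ drop i xs)" by simp
    also have "\<dots> = wt (take i xs @ y # drop (Suc i) xs)" by (simp only: t)
    also have "\<dots> = wt (take i xs @ [y]) * inv_degree y * wt (y # drop (Suc i) xs)"
      by (rule wt_split) (use len[OF xs] l in auto)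
    finally show ?thesis by (simp only: t)
  qed
  have "weight ?A = (\<Sum>xs\<in>?A. (\<lambda>(as, bs). wt as * inv_degree y * wt bs) (?g xs))"
    by (rule sum.cong[OF refl]) (simp only: prod.case, rule wt_eq)
  also have "\<dots> = (\<Sum>(as, bs)\<in>?g ` ?A. wt as * inv_degree y * wt bs)"
    by (subst sum.reindex[OF inj]) simp
  also have "\<dots> \<le> (\<Sum>(as, bs)\<in>?L \<times> ?R. wt as * inv_degree y * wt bs)"
    by (rule sum_mono2[OF _ img]) (use fin in auto)
  also have "\<dots> = weight ?L * inv_degree y * weight ?R"
    by (simp add: sum.cartesian_product[symmetric] sum_product[symmetric] sum_distrib_right sum_distrib_left mult.assoc)
  also have "\<dots> \<le> threshold i * (1 / \<delta>) * threshold (l - i)"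
    using l inv_degree_le[OF y] threshold_pos delta_ge_1
    by (intro mult_mono light_class mult_nonneg_nonneg) (auto intro: less_imp_le)
  also have "\<dots> = threshold l / K"
    using threshold_mult[of i "l - i"] l K_gt_1 by (simp add: field_simps)
  finally show ?thesis .
qed

section \<open>Families of internally disjoint paths\<close>

abbreviation inner :: "'v list \<Rightarrow> 'v set" where
  "inner xs \<equiv> set (butlast (tl xs))"

lemma inner_nth:
  assumes "length xs = Suc l" "y \<in> inner xs"
  obtains i where "0 < i" "i < l" "xs ! i = y"
proof -
  obtain j where j: "j < length (butlast (tl xs))" "butlast (tl xs) ! j = y"
    using assms(2) by (auto simp: in_set_conv_nth)
  then have "xs ! Suc j = y" using assms(1) by (simp add: nth_butlast nth_tl)
  then show ?thesis using that[of "Suc j"] j(1) assms(1) by simp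
qed

text \<open>The inner vertices of a maximal disjoint subfamily meet every path of \<open>Q\<close>.
  There are at most \<open>D * l\<close> of them, each occurring at fewer than \<open>l\<close>
  positions, and \<open>weight_through\<close> bounds the paths for each choice of vertex and
  position.\<close>

lemma few_disjoint_weight:
  assumes l: "2 \<le> l" and x: "x \<in> V"
    and Q: "Q \<subseteq> {xs \<in> admissible l. hd xs = x \<and> last xs = z}"
    and no: "\<And>F. F \<subseteq> Q \<Longrightarrow> (\<forall>ys\<in>F. \<forall>zs\<in>F. ys \<noteq> zs \<longrightarrow> inner ys \<inter> inner zs = {}) \<Longrightarrow> card F \<noteq> D"
  shows "weight Q \<le> real (D * l ^ 2) * (threshold l / K)"
proof -
  have walk: "ys \<in> walks l" if "ys \<in> Q" for ys
    using Q admissible_subset[of l] l that by fastforce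
  have "Q \<subseteq> walks l" using walk by blast
  then have finQ: "finite Q" by (rule finite_subset) simp
  let ?disj = "\<lambda>F. F \<subseteq> Q \<and> (\<forall>ys\<in>F. \<forall>zs\<in>F. ys \<noteq> zs \<longrightarrow> inner ys \<inter> inner zs = {})"
  have "finite (Collect ?disj)" using finQ by simp
  moreover have "{} \<in> Collect ?disj" by simp
  ultimately have "\<exists>F\<in>Collect ?disj. \<forall>F'\<in>Collect ?disj. F \<subseteq> F' \<longrightarrow> F = F'"
    by (intro finite_has_maximal) auto
  then obtain F where F: "?disj F" and max: "\<And>F'. ?disj F' \<Longrightarrow> F \<subseteq> F' \<Longrightarrow> F = F'"
    by auto
  have finF: "finite F" using F finQ by (metis finite_subset)
  have cardF: "card F \<le> D"
  proof (rule ccontr)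
    assume "\<not> card F \<le> D"
    then obtain F' where "F' \<subseteq> F" "card F' = D"
      using obtain_subset_with_card_n[of D F] by (metis nat_le_linear)
    then show False using no[of F'] F by blast
  qed
  define U where "U = (\<Union>ys\<in>F. inner ys)"
  have inner_len: "card (inner ys) \<le> l" if "ys \<in> Q" for ys
    using card_length[of "butlast (tl ys)"] walks_lengthD[OF walk[OF that]] by simp
  have finU: "finite U" using finF by (simp add: U_def)
  have "card U \<le> (\<Sum>ys\<in>F. card (inner ys))"
    unfolding U_def by (rule card_UN_le[OF finF])
  also have "\<dots> \<le> (\<Sum>ys\<in>F. l)" using F inner_len by (intro sum_mono) auto
  also have "\<dots> \<le> D * l" using cardF by simp
  finally have cardU: "card U \<le> D * l" .
  have UV: "U \<subseteq> V"
  proof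
    fix y assume "y \<in> U"
    then obtain ys where ys: "ys \<in> F" "y \<in> inner ys" by (auto simp: U_def)
    then have "y \<in> set ys" by (cases ys) (auto dest: in_set_butlastD)
    then show "y \<in> V" using walk[of ys] F ys by (auto simp: walks_def)
  qed
  let ?S = "\<lambda>y i. {xs \<in> admissible l. hd xs = x \<and> last xs = z \<and> xs ! i = y}"
  have cover: "Q \<subseteq> (\<Union>(y, i)\<in>U \<times> {0<..<l}. ?S y i)"
  proof
    fix xs assume xs: "xs \<in> Q"
    have "\<exists>y. y \<in> inner xs \<and> y \<in> U"
    proof (cases "xs \<in> F")
      case True
      \<comment> \<open>Here \<open>l \<ge> 2\<close> provides an inner vertex, so a member of
        \<open>F\<close> is itself met by \<open>U\<close>.\<close>
      have "butlast (tl xs) \<noteq> []"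
        using walks_lengthD[OF walk[OF xs]] l
        by (simp flip: length_greater_0_conv)
      then have "hd (butlast (tl xs)) \<in> inner xs" by simp
      then show ?thesis using True by (auto simp: U_def)
    next
      case False
      have "\<exists>ys\<in>F. inner xs \<inter> inner ys \<noteq> {}"
      proof (rule ccontr)
        assume "\<not> ?thesis"
        then have "?disj (insert xs F)" using F xs by (auto simp: Int_commute)
        then show False using max[of "insert xs F"] False by auto
      qed
      then show ?thesis by (auto simp: U_def)
    qed
    then obtain y where y: "y \<in> inner xs" "y \<in> U" by blast
    from inner_nth[OF walks_lengthD[OF walk[OF xs]] y(1)]
    obtain i where "0 < i" "i < l" "xs ! i = y" by metis
    then show "xs \<in> (\<Union>(y, i)\<in>U \<times> {0<..<l}. ?S y i)"
      using y Q xs by (intro UN_I[of "(y, i)"]) auto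
  qed
  have finS: "finite (?S y i)" for y i
    using admissible_subset[of l] l finite_subset[OF _ finite_walks[of l]] by auto
  have "weight Q \<le> weight (\<Union>(y, i)\<in>U \<times> {0<..<l}. ?S y i)"
    by (rule sum_mono2[OF _ cover]) (use finU finS in auto)
  also have "\<dots> \<le> (\<Sum>p\<in>U \<times> {0<..<l}. weight (case p of (y, i) \<Rightarrow> ?S y i))"
    by (rule weight_UN_le) (use finU finS in auto)
  also have "\<dots> \<le> (\<Sum>p\<in>U \<times> {0<..<l}. threshold l / K)"
  proof (rule sum_mono)
    fix p assume "p \<in> U \<times> {0<..<l}"
    then obtain y i where "p = (y, i)" "y \<in> V" "0 < i" "i < l" using UV by auto
    then show "weight (case p of (y, i) \<Rightarrow> ?S y i) \<le> threshold l / K"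
      using weight_through[of i l x y z] x by simp
  qed
  also have "\<dots> = real (card U * (l - 1)) * (threshold l / K)"
    by (simp add: card_cartesian_product)
  also have "\<dots> \<le> real (D * l ^ 2) * (threshold l / K)"
  proof (rule mult_right_mono)
    have "card U * (l - 1) \<le> (D * l) * l" using cardU by (intro mult_le_mono) auto
    then show "real (card U * (l - 1)) \<le> real (D * l ^ 2)"
      by (simp only: of_nat_le_iff power2_eq_square mult.assoc)
  qed (use threshold_pos[of l] K_gt_1 in auto)
  finally show ?thesis .
qed

text \<open>A smallest subfamily on which the potential \<open>\<Phi>\<close> is positive has the required properties: dropping
  all paths with a given prefix, or with a given end point, saves the cost charged for it in \<open>\<Phi>\<close>.\<close>

lemma rich_subfamily:
  assumes l: "2 \<le> l" and x: "x \<in> V" and eps: "0 < \<epsilon>"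
    and P: "P = {xs \<in> heavy l. hd xs = x}"
    and wP: "\<epsilon> * real (card (nb x)) \<le> weight P"
    and K: "2 * real (D * l ^ 2) \<le> K"
    and delta: "2 * real l * real D < \<epsilon> * \<delta>"
  obtains Q where "Q \<subseteq> P" "Q \<noteq> {}"
    and "\<forall>xs\<in>Q. \<forall>i<l. D \<le> card {y. \<exists>ys\<in>Q. take (Suc (Suc i)) ys = take (Suc i) xs @ [y]}"
    and "\<forall>xs\<in>Q. \<exists>F. F \<subseteq> {ys \<in> Q. last ys = last xs} \<and>
      (\<forall>ys\<in>F. \<forall>zs\<in>F. ys \<noteq> zs \<longrightarrow> inner ys \<inter> inner zs = {}) \<and> card F = D"
proof -
  have Pw: "P \<subseteq> walks l" using admissible_subset[of l] l by (auto simp: P heavy_def)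
  have finP: "finite P" using Pw by (rule finite_subset) simp
  \<comment> \<open>Each surviving proper prefix is charged the most that the paths through it can
    weigh when it has at most \<open>D\<close> continuations. In \<open>\<Phi>\<close> each
    surviving end point is charged half a threshold.\<close>
  define cp where "cp Q = (\<Sum>i<l. \<Sum>p\<in>take (Suc i) ` Q. real D * prefix_cost p)" for Q
  define \<Phi> where "\<Phi> Q = weight Q - cp Q - real (card (last ` Q)) * (threshold l / 2)" for Q
  have take_walk: "take (Suc i) xs \<in> walks i" if "xs \<in> walks l" "i \<le> l" for xs i
    using that set_take_subset[of "Suc i" xs] successively_append_iff[of E "take (Suc i) xs" "drop (Suc i) xs"]
    by (auto simp: walks_def)
  have cost_P: "cp P \<le> real l * (real D * (real (card (nb x)) / \<delta>))"
  proof -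
    have "(\<Sum>p\<in>take (Suc i) ` P. real D * prefix_cost p) \<le> real D * (real (card (nb x)) / \<delta>)"
      if "i < l" for i
    proof -
      have "(\<Sum>p\<in>take (Suc i) ` P. real D * prefix_cost p)
          \<le> (\<Sum>p\<in>{p \<in> walks i. hd p = x}. real D * prefix_cost p)"
      proof (rule sum_mono2)
        show "take (Suc i) ` P \<subseteq> {p \<in> walks i. hd p = x}"
          using take_walk Pw that by (auto simp: P)
      qed auto
      also have "\<dots> = real D * sum prefix_cost {p \<in> walks i. hd p = x}" by (simp add: sum_distrib_left)
      also have "\<dots> \<le> real D * (real (card (nb x)) / \<delta>)"
        by (intro mult_left_mono sum_prefix_cost x) simp
      finally show ?thesis .
    qed
    then have "cp P \<le> (\<Sum>i<l. real D * (real (card (nb x)) / \<delta>))"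
      unfolding cp_def by (intro sum_mono) auto
    then show ?thesis by simp
  qed
  \<comment> \<open>The paths of \<open>P\<close> are heavy, so each end point carries at least a
    full threshold, and the end point charges use at most half of \<open>weight P\<close>.\<close>
  have ends_P: "real (card (last ` P)) * threshold l \<le> weight P"
  proof -
    have "(\<Sum>z\<in>last ` P. threshold l) \<le> (\<Sum>z\<in>last ` P. weight {xs \<in> P. last xs = z})"
    proof (rule sum_mono)
      fix z assume "z \<in> last ` P"
      then obtain xs where xs: "xs \<in> P" "last xs = z" by auto
      obtain n where n: "l = Suc n" using l by (cases l) auto
      have "threshold l \<le> weight {ys \<in> extend n (light n). hd ys = hd xs \<and> last ys = last xs}"
        using xs by (auto simp: P heavy_def n)
      also have "{ys \<in> extend n (light n). hd ys = hd xs \<and> last ys = last xs} = {ys \<in> P. last ys = z}"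
        using xs by (auto simp: P heavy_def n)
      finally show "threshold l \<le> weight {xs \<in> P. last xs = z}" .
    qed
    also have "\<dots> = weight P"
      by (rule sum.image_gen[symmetric]) (rule finP)
    finally show ?thesis by simp
  qed
  have nbx: "0 < real (card (nb x))" using card_nb[OF x] delta_ge_1 by linarith
  \<comment> \<open>By \<open>delta\<close> the prefix charges stay below half of
    \<open>\<epsilon> * card (nb x)\<close>, hence below the other half of
    \<open>weight P\<close>.\<close>
  have "0 < \<Phi> P"
  proof -
    have "2 * (real l * (real D * (real (card (nb x)) / \<delta>))) = (2 * real l * real D) * (real (card (nb x)) / \<delta>)"
      by simp
    also have "\<dots> < (\<epsilon> * \<delta>) * (real (card (nb x)) / \<delta>)"
      using delta nbx delta_ge_1 by (intro mult_strict_right_mono) auto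
    also have "\<dots> = \<epsilon> * real (card (nb x))" using delta_ge_1 by simp
    finally show ?thesis using cost_P ends_P wP unfolding \<Phi>_def by simp
  qed
  define Q where "Q = arg_min card (\<lambda>Q. Q \<subseteq> P \<and> 0 < \<Phi> Q)"
  have Q: "Q \<subseteq> P" "0 < \<Phi> Q"
    using arg_min_natI[of "\<lambda>Q. Q \<subseteq> P \<and> 0 < \<Phi> Q" P card] \<open>0 < \<Phi> P\<close> by (auto simp: Q_def)
  have min: "card Q \<le> card Q'" if "Q' \<subseteq> P" "0 < \<Phi> Q'" for Q'
    unfolding Q_def by (rule arg_min_nat_le) (use that in auto)
  have finQ: "finite Q" using Q(1) finP by (rule finite_subset)
  have cp_mono: "cp Q' \<le> cp Q" if "Q' \<subseteq> Q" for Q'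
    unfolding cp_def using that finQ by (intro sum_mono sum_mono2) auto
  \<comment> \<open>A removal that saves at least the weight it loses would keep
    \<open>\<Phi>\<close> positive on a smaller family.\<close>
  have no_removal: False if "R \<subseteq> Q" "R \<noteq> {}"
    "weight R + cp (Q - R) + real (card (last ` (Q - R))) * (threshold l / 2)
      \<le> cp Q + real (card (last ` Q)) * (threshold l / 2)" for R
  proof -
    have "weight (Q - R) = weight Q - weight R" using that(1) finQ by (simp add: sum_diff)
    then have "0 < \<Phi> (Q - R)" using Q(2) that(3) by (simp add: \<Phi>_def)
    then have "card Q \<le> card (Q - R)" using Q(1) by (intro min) auto
    moreover have "card (Q - R) < card Q" using that finQ by (intro psubset_card_mono) auto
    ultimately show False by simp
  qed
  show ?thesis
  proof (intro that[OF Q(1)] ballI allI impI)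
    show "Q \<noteq> {}" using Q(2) by (auto simp: \<Phi>_def cp_def)
  next
    fix xs i assume xs: "xs \<in> Q" and i: "i < l"
    define p where "p = take (Suc i) xs"
    define Y where "Y = {y. \<exists>ys\<in>Q. take (Suc (Suc i)) ys = p @ [y]}"
    have lenQ: "length ys = Suc l" if "ys \<in> Q" for ys
      using that Q(1) Pw walks_lengthD by blast
    have finY: "finite Y"
    proof (rule finite_subset)
      show "Y \<subseteq> (\<lambda>ys. last (take (Suc (Suc i)) ys)) ` Q"
      proof
        fix y assume "y \<in> Y"
        then obtain ys where ys: "ys \<in> Q" "take (Suc (Suc i)) ys = p @ [y]" by (auto simp: Y_def)
        then have "last (take (Suc (Suc i)) ys) = y" by simp
        then show "y \<in> (\<lambda>ys. last (take (Suc (Suc i)) ys)) ` Q" using ys(1) by (metis image_eqI)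
      qed
    qed (use finQ in simp)
    have p_len: "length p = Suc i" using lenQ[OF xs] i by (simp add: p_def)
    show "D \<le> card {y. \<exists>ys\<in>Q. take (Suc (Suc i)) ys = take (Suc i) xs @ [y]}"
    proof (rule ccontr)
      assume "\<not> ?thesis"
      then have few: "card Y \<le> D" by (simp add: Y_def p_def)
      let ?R = "{ys \<in> Q. take (Suc i) ys = p}"
      have cover: "?R \<subseteq> (\<Union>y\<in>Y. {ys \<in> walks l. take (Suc (Suc i)) ys = p @ [y]})"
      proof
        fix ys assume ys: "ys \<in> ?R"
        then have "take (Suc (Suc i)) ys = p @ [ys ! Suc i]"
          using lenQ[of ys] i by (simp add: take_Suc_conv_app_nth)
        moreover from this have "ys ! Suc i \<in> Y" using ys by (auto simp: Y_def)
        ultimately show "ys \<in> (\<Union>y\<in>Y. {ys \<in> walks l. take (Suc (Suc i)) ys = p @ [y]})"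
          using ys Q(1) Pw by blast
      qed
      have "weight ?R \<le> weight (\<Union>y\<in>Y. {ys \<in> walks l. take (Suc (Suc i)) ys = p @ [y]})"
        by (rule sum_mono2[OF _ cover]) (use finY in auto)
      also have "\<dots> \<le> (\<Sum>y\<in>Y. weight {ys \<in> walks l. take (Suc (Suc i)) ys = p @ [y]})"
        by (rule weight_UN_le) (use finY in auto)
      also have "\<dots> = (\<Sum>y\<in>Y. prefix_cost p)"
      proof (rule sum.cong[OF refl])
        fix y assume "y \<in> Y"
        then obtain ys where ys: "ys \<in> Q" "take (Suc (Suc i)) ys = p @ [y]" by (auto simp: Y_def)
        have "p @ [y] \<in> walks (Suc i)"
          using take_walk[of ys "Suc i"] ys i Q(1) Pw by auto
        then have "weight {ys \<in> walks l. take (Suc (Suc i)) ys = p @ [y]} = wt (p @ [y])"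
          using i by (intro weight_prefix) auto
        then show "weight {ys \<in> walks l. take (Suc (Suc i)) ys = p @ [y]} = prefix_cost p"
          using p_len by (subst (asm) wt_snoc_cost) auto
      qed
      also have "\<dots> \<le> real D * prefix_cost p"
        using few by (simp add: mult_right_mono)
      finally have wR: "weight ?R \<le> real D * prefix_cost p" .
      \<comment> \<open>Without \<open>?R\<close> the prefix \<open>p\<close> has vanished from the
        summand for \<open>i\<close>; the summands for other lengths cannot grow.\<close>
      have "cp (Q - ?R) + real D * prefix_cost p \<le> cp Q"
      proof -
        let ?f = "\<lambda>Q j. \<Sum>p\<in>take (Suc j) ` Q. real D * prefix_cost p"
        have 1: "?f (Q - ?R) j \<le> ?f Q j" for j
          using finQ by (intro sum_mono2) auto
        have "?f (Q - ?R) i + real D * prefix_cost p = (\<Sum>p\<in>insert p (take (Suc i) ` (Q - ?R)). real D * prefix_cost p)"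
          using finQ by (subst sum.insert) auto
        also have "\<dots> \<le> ?f Q i"
          using finQ xs by (intro sum_mono2) (auto simp: p_def)
        finally have 2: "?f (Q - ?R) i + real D * prefix_cost p \<le> ?f Q i" .
        have split: "cp S = ?f S i + (\<Sum>j\<in>{..<l} - {i}. ?f S j)" for S
          unfolding cp_def using i by (subst sum.remove[of _ i]) auto
        have "(\<Sum>j\<in>{..<l} - {i}. ?f (Q - ?R) j) \<le> (\<Sum>j\<in>{..<l} - {i}. ?f Q j)"
          by (intro sum_mono 1)
        then show ?thesis using 2 split[of Q] split[of "Q - ?R"] by linarith
      qed
      moreover have "real (card (last ` (Q - ?R))) * (threshold l / 2) \<le> real (card (last ` Q)) * (threshold l / 2)"
        using finQ threshold_pos[of l] by (intro mult_right_mono) (auto intro!: card_mono)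
      ultimately show False
        using wR xs by (intro no_removal[of ?R]) (auto simp: p_def)
    qed
  next
    fix xs assume xs: "xs \<in> Q"
    let ?R = "{ys \<in> Q. last ys = last xs}"
    show "\<exists>F. F \<subseteq> ?R \<and> (\<forall>ys\<in>F. \<forall>zs\<in>F. ys \<noteq> zs \<longrightarrow> inner ys \<inter> inner zs = {}) \<and> card F = D"
    proof (rule ccontr)
      assume no: "\<not> ?thesis"
      have "weight ?R \<le> real (D * l ^ 2) * (threshold l / K)"
      proof (rule few_disjoint_weight[OF l x, where z = "last xs"])
        show "?R \<subseteq> {ys \<in> admissible l. hd ys = x \<and> last ys = last xs}"
          using Q(1) by (auto simp: P heavy_def)
        show "card F \<noteq> D" if "F \<subseteq> ?R" "\<forall>ys\<in>F. \<forall>zs\<in>F. ys \<noteq> zs \<longrightarrow> inner ys \<inter> inner zs = {}" for F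
          using no that by blast
      qed
      also have "\<dots> = (real (D * l ^ 2) / K) * threshold l" by simp
      also have "\<dots> \<le> (1 / 2) * threshold l"
        using K K_gt_1 threshold_pos[of l] by (intro mult_right_mono) (auto simp: field_simps)
      finally have wR: "weight ?R \<le> threshold l / 2" by simp
      have "last ` (Q - ?R) = last ` Q - {last xs}" by auto
      then have "card (last ` Q) = Suc (card (last ` (Q - ?R)))"
        using finQ xs card_Suc_Diff1[of "last ` Q" "last xs"] by simp
      then have "real (card (last ` Q)) * (threshold l / 2)
         = real (card (last ` (Q - ?R))) * (threshold l / 2) + threshold l / 2"
        by (simp add: algebra_simps)
      moreover have "cp (Q - ?R) \<le> cp Q" by (rule cp_mono) auto
      ultimately have "weight ?R + cp (Q - ?R) + real (card (last ` (Q - ?R))) * (threshold l / 2)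
          \<le> cp Q + real (card (last ` Q)) * (threshold l / 2)"
        using wR by linarith
      then show False
        using xs by (intro no_removal[of ?R]) auto
    qed
  qed
qed

text \<open>By averaging, some \<open>x\<close> starts heavy paths of weight at least
  \<open>\<epsilon> * card (nb x)\<close>, since \<open>vol\<close> is the sum of the degrees. The
  levels of the host are the sets of \<open>j\<close>-th vertices of the rich subfamily for
  \<open>x\<close>.\<close>

lemma level_host_exists:
  assumes k: "1 \<le> k" and eps: "0 < \<epsilon>" and big: "\<delta> ^ k > 2 * K ^ (2 * k - 1) * real (card V)"
    and small: "2 ^ k * (\<epsilon> + (real k + 1) / \<delta>) \<le> 1 / 2"
    and K: "2 * real (D * k ^ 2) \<le> K" and delta: "2 * real k * real D < \<epsilon> * \<delta>"
  shows "\<exists>l x A. 2 \<le> l \<and> l \<le> k \<and> level_host E x A l D \<and> (\<forall>i\<le>l. A i \<subseteq> V)"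
proof -
  obtain l where l: "2 \<le> l" "l \<le> k" "\<epsilon> * vol \<le> weight (heavy l)"
    using heavy_length_exists[OF k eps big small] by blast
  have heavy_walks: "heavy l \<subseteq> walks l"
    using admissible_subset[of l] l by (auto simp: heavy_def)
  have "\<exists>x\<in>V. \<epsilon> * real (card (nb x)) \<le> weight {xs \<in> heavy l. hd xs = x}"
  proof (rule ccontr)
    assume "\<not> ?thesis"
    then have "(\<Sum>x\<in>V. weight {xs \<in> heavy l. hd xs = x}) < (\<Sum>x\<in>V. \<epsilon> * real (card (nb x)))"
      using finite_V V_nonempty by (intro sum_strict_mono) (auto simp: not_le)
    then show False
      using l(3) weight_by_hd[OF heavy_walks] by (simp add: vol_def sum_distrib_left)
  qed
  then obtain x where x: "x \<in> V" "\<epsilon> * real (card (nb x)) \<le> weight {xs \<in> heavy l. hd xs = x}" by blast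
  have "real (D * l ^ 2) \<le> real (D * k ^ 2)"
    using l(2) by (simp only: of_nat_le_iff) (intro mult_le_mono power_mono, auto)
  then have K': "2 * real (D * l ^ 2) \<le> K" using K by linarith
  have "2 * real l * real D \<le> 2 * real k * real D" using l(2) by (intro mult_right_mono) auto
  then have delta': "2 * real l * real D < \<epsilon> * \<delta>" using delta by linarith
  obtain Q where Q: "Q \<subseteq> {xs \<in> heavy l. hd xs = x}" "Q \<noteq> {}"
    and branch: "\<forall>xs\<in>Q. \<forall>i<l. D \<le> card {y. \<exists>ys\<in>Q. take (Suc (Suc i)) ys = take (Suc i) xs @ [y]}"
    and disj: "\<forall>xs\<in>Q. \<exists>F. F \<subseteq> {ys \<in> Q. last ys = last xs} \<and>
      (\<forall>ys\<in>F. \<forall>zs\<in>F. ys \<noteq> zs \<longrightarrow> inner ys \<inter> inner zs = {}) \<and> card F = D"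
    using rich_subfamily[OF l(1) x(1) eps refl x(2) K' delta'] by blast
  have Qw: "length xs = Suc l" "set xs \<subseteq> V" "successively E xs" "hd xs = x" "distinct xs"
    if "xs \<in> Q" for xs
  proof -
    have "xs \<in> heavy l" "hd xs = x" using Q(1) that by auto
    moreover from this have "xs \<in> walks l" using heavy_walks by blast
    ultimately show "length xs = Suc l" "set xs \<subseteq> V" "successively E xs" "hd xs = x" "distinct xs"
      by (auto simp: walks_def heavy_def extend_def)
  qed
  define A where "A j = (\<lambda>xs. xs ! j) ` Q" for j
  have A_V: "A i \<subseteq> V" if "i \<le> l" for i
  proof
    fix y assume "y \<in> A i"
    then obtain xs where xs: "xs \<in> Q" "y = xs ! i" by (auto simp: A_def)
    then have "y \<in> set xs" using Qw(1)[of xs] that by simp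
    then show "y \<in> V" using Qw(2)[OF xs(1)] by blast
  qed
  have "level_host E x A l D"
    unfolding level_host_def
  proof (intro conjI allI ballI impI)
    have x0: "xs ! 0 = x" if "xs \<in> Q" for xs
      using Qw(1,4)[OF that] by (cases xs) auto
    then show "A 0 = {x}" using Q(2) by (auto simp: A_def)
  next
    fix j y assume j: "j < l" and "y \<in> A j"
    then obtain xs where xs: "xs \<in> Q" "y = xs ! j" by (auto simp: A_def)
    \<comment> \<open>The continuations of the prefix of one path through \<open>y\<close> already
      give \<open>D\<close> neighbours; other paths through \<open>y\<close> can only add
      more.\<close>
    have "{y'. \<exists>ys\<in>Q. take (Suc (Suc j)) ys = take (Suc j) xs @ [y']} \<subseteq> {z \<in> A (Suc j). E y z}"
    proof
      fix z assume "z \<in> {y'. \<exists>ys\<in>Q. take (Suc (Suc j)) ys = take (Suc j) xs @ [y']}"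
      then obtain ys where ys: "ys \<in> Q" "take (Suc (Suc j)) ys = take (Suc j) xs @ [z]" by auto
      have len: "length xs = Suc l" "length ys = Suc l" using Qw xs ys by auto
      have "take (Suc (Suc j)) ys ! Suc j = z" "take (Suc (Suc j)) ys ! j = xs ! j"
        unfolding ys(2) using len j by (auto simp: nth_append)
      then have "ys ! Suc j = z" "ys ! j = y" using xs by auto
      moreover have "E (ys ! j) (ys ! Suc j)"
        using Qw(3)[OF ys(1)] len j by (auto simp: successively_conv_nth)
      ultimately show "z \<in> {z \<in> A (Suc j). E y z}" using ys(1) by (auto simp: A_def)
    qed
    moreover have "finite {z \<in> A (Suc j). E y z}"
      using A_V[of "Suc j"] j finite_subset[OF _ finite_V] by auto
    ultimately have "card {y'. \<exists>ys\<in>Q. take (Suc (Suc j)) ys = take (Suc j) xs @ [y']} \<le> card {z \<in> A (Suc j). E y z}"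
      by (intro card_mono)
    then show "D \<le> card {z \<in> A (Suc j). E y z}" using branch xs(1) j by (meson order_trans)
  next
    fix z assume "z \<in> A l"
    then obtain xs where xs: "xs \<in> Q" "z = xs ! l" by (auto simp: A_def)
    then have z: "z = last xs" using Qw(1)[OF xs(1)] by (cases xs rule: rev_cases) auto
    obtain F where F: "F \<subseteq> {ys \<in> Q. last ys = last xs}"
      "\<forall>ys\<in>F. \<forall>zs\<in>F. ys \<noteq> zs \<longrightarrow> inner ys \<inter> inner zs = {}" "card F = D"
      using disj xs(1) by blast
    have "length ys = Suc l \<and> distinct ys \<and> last ys = z \<and> successively E ys \<and> (\<forall>i\<le>l. ys ! i \<in> A i)"
      if "ys \<in> F" for ys
      using that F(1) Qw[of ys] z by (auto simp: A_def)
    then show "\<exists>F. card F = D \<and> (\<forall>ys\<in>F. \<forall>zs\<in>F. ys \<noteq> zs \<longrightarrow> inner ys \<inter> inner zs = {}) \<and>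
        (\<forall>ys\<in>F. length ys = Suc l \<and> distinct ys \<and> last ys = z \<and> successively E ys \<and> (\<forall>i\<le>l. ys ! i \<in> A i))"
      using F(2,3) by blast
  qed
  then show ?thesis using l A_V by blast
qed

end

section \<open>Greedy embedding of levelled forests\<close>

text \<open>Otherwise a choice of one point of \<open>U\<close> in each member would be injective on
  \<open>F\<close>.\<close>

lemma disjoint_family_avoids:
  assumes "finite U" "card U < card F"
    and disj: "\<And>a b. a \<in> F \<Longrightarrow> b \<in> F \<Longrightarrow> a \<noteq> b \<Longrightarrow> g a \<inter> g b = {}"
  shows "\<exists>a\<in>F. g a \<inter> U = {}"
proof (rule ccontr)
  assume "\<not> ?thesis"
  then have "\<forall>a\<in>F. \<exists>u. u \<in> g a \<inter> U" by blast
  then obtain h where h: "\<And>a. a \<in> F \<Longrightarrow> h a \<in> g a \<inter> U" by metis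
  have "inj_on h F"
  proof (rule inj_onI, rule ccontr)
    fix a b assume "a \<in> F" "b \<in> F" "h a = h b" "a \<noteq> b"
    then show False using h[of a] h[of b] disj[of a b] by auto
  qed
  moreover have "h ` F \<subseteq> U" using h by blast
  ultimately have "card F \<le> card U" using assms(1) by (rule card_inj_on_le)
  then show False using assms(2) by simp
qed

text \<open>The assumption \<open>unique_lower\<close> makes the levels below \<open>l\<close> a
  tree. Acyclicity of the graph without \<open>v\<close> appears in \<open>forest\<close> in the
  form that is used: no two distinct neighbours of \<open>w\<close>, apart from \<open>v\<close>,
  are joined by a walk avoiding \<open>v\<close> and \<open>w\<close>.\<close>

locale levelled_forest =
  fixes VH :: "'a set" and R :: "'a \<Rightarrow> 'a \<Rightarrow> bool" and v :: 'a
    and lev :: "'a \<Rightarrow> nat" and l :: nat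
  assumes finite_VH: "finite VH" and v_in: "v \<in> VH"
    and R_sym: "R a b \<Longrightarrow> R b a" and R_in: "R a b \<Longrightarrow> a \<in> VH"
    and l_ge_2: "2 \<le> l"
    and lev_v: "lev v = 0"
    and lev_0: "a \<in> VH \<Longrightarrow> lev a = 0 \<Longrightarrow> a = v"
    and lev_step: "R a b \<Longrightarrow> lev a = Suc (lev b) \<or> lev b = Suc (lev a)"
    and lower: "a \<in> VH \<Longrightarrow> a \<noteq> v \<Longrightarrow> \<exists>b. R a b \<and> lev b < lev a"
    and unique_lower: "R a b \<Longrightarrow> R a c \<Longrightarrow> lev b < lev a \<Longrightarrow> lev c < lev a \<Longrightarrow> lev a < l \<Longrightarrow> b = c"
    and forest: "w \<noteq> v \<Longrightarrow> R w a \<Longrightarrow> R w b \<Longrightarrow> a \<noteq> v \<Longrightarrow> b \<noteq> v \<Longrightarrow>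
      (a, b) \<in> {(p, q). R p q \<and> p \<in> VH - {v, w} \<and> q \<in> VH - {v, w}}\<^sup>* \<Longrightarrow> a = b"
begin

text \<open>The closure is reflexive, so each vertex is related to itself even if it lies outside
  \<open>T\<close>.\<close>

definition conn :: "'a set \<Rightarrow> ('a \<times> 'a) set" where
  "conn T = {(p, q). R p q \<and> p \<in> T \<and> q \<in> T}\<^sup>*"

text \<open>Vertices above level \<open>l\<close> are placed alternately on the host levels \<open>l - 1\<close> and \<open>l\<close>.\<close>

definition target :: "'a \<Rightarrow> nat" where
  "target a = (if lev a \<le> l then lev a else if even (lev a + l) then l else l - 1)"

definition embeds :: "('v \<Rightarrow> 'v \<Rightarrow> bool) \<Rightarrow> (nat \<Rightarrow> 'v set) \<Rightarrow> 'a set \<Rightarrow> ('a \<Rightarrow> 'v) \<Rightarrow> bool" where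
  "embeds E A S f \<longleftrightarrow> inj_on f S \<and> (\<forall>a\<in>S. \<forall>b\<in>S. R a b \<longrightarrow> E (f a) (f b)) \<and>
     (\<forall>a\<in>S. f a \<in> A (target a))"

text \<open>The vertex sets embedded on the way. The last condition says that \<open>S\<close> meets every component of
  the forest in a connected set, so a new vertex is attached to at most one old vertex besides \<open>v\<close>.\<close>

definition closed :: "'a set \<Rightarrow> bool" where
  "closed S \<longleftrightarrow> v \<in> S \<and> S \<subseteq> VH \<and>
     (\<forall>a\<in>S. \<forall>b. lev a < l \<longrightarrow> R a b \<longrightarrow> lev b < lev a \<longrightarrow> b \<in> S) \<and>
     (\<forall>a\<in>S - {v}. \<forall>b\<in>S - {v}. (a, b) \<in> conn (VH - {v}) \<longrightarrow> (a, b) \<in> conn (S - {v}))"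

section \<open>Closed vertex sets and chains to the root\<close>

lemma conn_sym: "(a, b) \<in> conn T \<Longrightarrow> (b, a) \<in> conn T"
  unfolding conn_def by (rule symD[OF sym_rtrancl]) (auto simp: sym_def dest: R_sym)

lemma conn_trans: "(a, b) \<in> conn T \<Longrightarrow> (b, c) \<in> conn T \<Longrightarrow> (a, c) \<in> conn T"
  unfolding conn_def by (rule rtrancl_trans)

lemma conn_mono: "T \<subseteq> T' \<Longrightarrow> (a, b) \<in> conn T \<Longrightarrow> (a, b) \<in> conn T'"
  unfolding conn_def by (erule rtrancl_mono[THEN subsetD, rotated]) auto

lemma conn_edge: "R a b \<Longrightarrow> a \<in> T \<Longrightarrow> b \<in> T \<Longrightarrow> (a, b) \<in> conn T"
  unfolding conn_def by auto

lemma conn_refl: "(a, a) \<in> conn T"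
  unfolding conn_def by simp

lemma R_in2: "R a b \<Longrightarrow> b \<in> VH"
  using R_sym R_in by blast

text \<open>Through \<open>w\<close>, the vertices \<open>a\<close> and \<open>b\<close> lie in one
  component of the forest, so closedness joins them inside \<open>S\<close>, avoiding
  \<open>w\<close>. Then \<open>c\<close> and \<open>a\<close> are neighbours of \<open>w\<close>
  joined around \<open>w\<close>, and \<open>forest\<close> identifies them. With
  \<open>b = c\<close> this says that \<open>w\<close> has at most one old neighbour besides
  \<open>v\<close>.\<close>

lemma unique_attachment:
  assumes S: "closed S" and w: "w \<notin> S" and a: "R w a" "a \<in> S" "a \<noteq> v"
    and c: "R w c" "c \<noteq> v" and b: "b \<in> S" "b \<noteq> v" "(c, b) \<in> conn (VH - {v, w})"
  shows "c = a"
proof -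
  have vS: "v \<in> S" "S \<subseteq> VH" using S by (auto simp: closed_def)
  then have wv: "w \<noteq> v" using w by auto
  have "(a, w) \<in> conn (VH - {v})" "(w, c) \<in> conn (VH - {v})"
    using a c wv R_in R_in2 R_sym by (auto intro!: conn_edge)
  moreover have "(c, b) \<in> conn (VH - {v})" using b(3) by (rule conn_mono[rotated]) auto
  ultimately have "(a, b) \<in> conn (VH - {v})" using conn_trans by blast
  then have "(a, b) \<in> conn (S - {v})" using S a b by (auto simp: closed_def)
  then have "(a, b) \<in> conn (VH - {v, w})" by (rule conn_mono[rotated]) (use vS w in auto)
  then have "(a, c) \<in> conn (VH - {v, w})" using b(3) conn_sym conn_trans by blast
  then show ?thesis using forest[of w a c] wv a c by (simp add: conn_def)
qed

text \<open>All new vertices hang on the component of the single old vertex \<open>a\<close>, so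
  connectivity in \<open>S'\<close> only has to be checked towards \<open>a\<close>.\<close>

lemma closed_extend:
  assumes S: "closed S" and S': "S \<subseteq> S'" "S' \<subseteq> VH"
    and low: "\<And>u b. u \<in> S' - S \<Longrightarrow> lev u < l \<Longrightarrow> R u b \<Longrightarrow> lev b < lev u \<Longrightarrow> b \<in> S'"
    and a: "a \<in> S - {v}" and con: "\<And>u. u \<in> S' - S \<Longrightarrow> (u, a) \<in> conn (S' - {v})"
  shows "closed S'"
proof -
  have "(u, b) \<in> conn (S' - {v})"
    if u: "u \<in> S' - {v}" and b: "b \<in> S' - {v}" and ub: "(u, b) \<in> conn (VH - {v})" for u b
  proof -
    have eq: "(x, a) \<in> conn (S' - {v})" if x: "x \<in> S' - {v}" and xa: "(x, a) \<in> conn (VH - {v})" for x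
    proof (cases "x \<in> S")
      case True
      then have "(x, a) \<in> conn (S - {v})" using S a x xa by (auto simp: closed_def)
      then show ?thesis by (rule conn_mono[rotated]) (use S' in auto)
    next
      case False
      then show ?thesis using con x by blast
    qed
    have toV: "(x, y) \<in> conn (VH - {v})" if "(x, y) \<in> conn (S' - {v})" for x y
      using that by (rule conn_mono[rotated]) (use S' in auto)
    show ?thesis
    proof (cases "u \<in> S \<and> b \<in> S")
      case True
      then have "(u, b) \<in> conn (S - {v})" using S u b ub by (auto simp: closed_def)
      then show ?thesis by (rule conn_mono[rotated]) (use S' in auto)
    next
      case False
      then have "(u, a) \<in> conn (VH - {v}) \<or> (b, a) \<in> conn (VH - {v})"
        using con toV u b by blast
      then have "(u, a) \<in> conn (VH - {v})" "(b, a) \<in> conn (VH - {v})"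
        using ub conn_sym conn_trans by blast+
      then show ?thesis using eq u b conn_sym conn_trans by blast
    qed
  qed
  then show ?thesis
    using S S' low unfolding closed_def by blast
qed

text \<open>Iterate \<open>lower\<close>; by \<open>lev_step\<close> each step descends by exactly
  one level.\<close>

lemma chain_exists:
  assumes "w \<in> VH"
  shows "\<exists>c. c 0 = v \<and> c (lev w) = w \<and> (\<forall>i\<le>lev w. c i \<in> VH \<and> lev (c i) = i) \<and>
    (\<forall>i<lev w. R (c i) (c (Suc i)))"
  using assms
proof (induction "lev w" arbitrary: w)
  case 0
  then have "w = v" using lev_0 by simp
  then show ?case using v_in lev_v by (intro exI[of _ "\<lambda>_. v"]) auto
next
  case (Suc n)
  then have "w \<noteq> v" using lev_v by auto
  then obtain b where b: "R w b" "lev b < lev w" using lower Suc.prems by blast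
  then have n: "n = lev b" using lev_step[OF b(1)] Suc(2) by auto
  then obtain c where c: "c 0 = v" "c (lev b) = b" "\<forall>i\<le>lev b. c i \<in> VH \<and> lev (c i) = i"
    "\<forall>i<lev b. R (c i) (c (Suc i))"
    using Suc(1)[OF n R_in2[OF b(1)]] by auto
  show ?case
    by (rule exI[of _ "c(Suc n := w)"])
       (use c n Suc(2,3) R_sym[OF b(1)] in \<open>auto simp: le_Suc_eq less_Suc_eq Suc(2)[symmetric]\<close>)
qed

lemma target_le: "target a \<le> l"
  by (simp add: target_def)

text \<open>These edges become moves up along the branching or moves from level \<open>l\<close> to
  \<open>l - 1\<close>, the two single steps that a host supports. What is left out are edges
  descending to a level below \<open>l\<close>.\<close>

lemma target_step:
  assumes "R a w" "l \<le> lev w \<or> lev w = Suc (lev a)"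
  shows "target a < l \<and> target w = Suc (target a) \<or> target a = l \<and> target w = l - 1"
proof -
  consider "lev w = Suc (lev a)" | "lev a = Suc (lev w)" "l \<le> lev w"
    using assms lev_step[OF assms(1)] by auto
  then show ?thesis
  proof cases
    case 1
    then show ?thesis using l_ge_2 by (cases "lev a" l rule: linorder_cases) (auto simp: target_def)
  next
    case 2
    then show ?thesis using l_ge_2 by (cases "lev w = l") (auto simp: target_def)
  qed
qed

section \<open>Extending a partial embedding into a host\<close>

context
  fixes E :: "'v \<Rightarrow> 'v \<Rightarrow> bool" and x :: 'v and A :: "nat \<Rightarrow> 'v set" and D :: nat
  assumes E_sym: "\<And>a b. E a b \<Longrightarrow> E b a"
    and host: "level_host E x A l D"
    and D: "card VH < D"
begin

lemma A_0: "A 0 = {x}"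
  using host by (simp add: level_host_def)

text \<open>The family at \<open>z\<close> has \<open>D > card VH\<close> members with disjoint
  interiors, so the interior of one of them misses the image of \<open>S\<close>.\<close>

lemma back_path:
  assumes z: "z \<in> A l" and S: "S \<subseteq> VH"
  obtains ys where "length ys = Suc l" "distinct ys" "ys ! l = z"
    "\<And>i. i < l \<Longrightarrow> E (ys ! i) (ys ! Suc i)" "\<And>i. i \<le> l \<Longrightarrow> ys ! i \<in> A i"
    "\<And>i. 0 < i \<Longrightarrow> i < l \<Longrightarrow> ys ! i \<notin> f ` S"
proof -
  have "\<exists>F. card F = D \<and>
        (\<forall>ys\<in>F. \<forall>zs\<in>F. ys \<noteq> zs \<longrightarrow> set (butlast (tl ys)) \<inter> set (butlast (tl zs)) = {}) \<and>
        (\<forall>ys\<in>F. length ys = Suc l \<and> distinct ys \<and> last ys = z \<and> successively E ys \<and>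
           (\<forall>i\<le>l. ys ! i \<in> A i))"
    using host z by (simp add: level_host_def)
  then obtain F where F: "card F = D"
    "\<forall>ys\<in>F. \<forall>zs\<in>F. ys \<noteq> zs \<longrightarrow> set (butlast (tl ys)) \<inter> set (butlast (tl zs)) = {}"
    "\<And>ys. ys \<in> F \<Longrightarrow> length ys = Suc l \<and> distinct ys \<and> last ys = z \<and> successively E ys \<and> (\<forall>i\<le>l. ys ! i \<in> A i)"
    by blast
  have finS: "finite S" using S finite_VH by (rule finite_subset)
  have "card (f ` S) < card F"
    using card_image_le[OF finS, of f] card_mono[OF finite_VH S] D F(1) by linarith
  then obtain ys where ys: "ys \<in> F" "set (butlast (tl ys)) \<inter> f ` S = {}"
    using disjoint_family_avoids[of "f ` S" F "\<lambda>ys. set (butlast (tl ys))"] F(2) finS by auto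
  note Y = F(3)[OF ys(1)]
  have "ys ! i \<notin> f ` S" if i: "0 < i" "i < l" for i
  proof -
    have "butlast (tl ys) ! (i - 1) = ys ! i"
      using Y i by (simp add: nth_butlast nth_tl)
    moreover have "i - 1 < length (butlast (tl ys))" using Y i by simp
    ultimately have "ys ! i \<in> set (butlast (tl ys))" by (metis nth_mem)
    then show ?thesis using ys(2) by blast
  qed
  moreover have "ys ! l = z" using Y by (metis diff_Suc_1 last_conv_nth list.size(3) nat.distinct(1))
  moreover have "E (ys ! i) (ys ! Suc i)" if "i < l" for i
    using Y that by (auto simp: successively_conv_nth)
  ultimately show ?thesis
    by (intro that[of ys]) (use Y in auto)
qed

text \<open>For a move up, \<open>D\<close> neighbours of \<open>f a\<close> outnumber the used
  vertices. For a move down from level \<open>l\<close>, the vertex before \<open>f a\<close> on a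
  fresh back path is a free neighbour.\<close>

lemma embed_vertex:
  assumes f: "embeds E A S f" and S: "S \<subseteq> VH" and w: "w \<in> VH - S" and a: "a \<in> S" "R a w"
    and only: "\<And>b. b \<in> S \<Longrightarrow> R w b \<Longrightarrow> b = a"
    and tgt: "target a < l \<and> target w = Suc (target a) \<or> target a = l \<and> target w = l - 1"
  shows "\<exists>f'. embeds E A (insert w S) f'"
proof -
  have fa: "f a \<in> A (target a)" using f a by (auto simp: embeds_def)
  have finS: "finite S" using S finite_VH by (rule finite_subset)
  have "\<exists>y. y \<in> A (target w) \<and> E (f a) y \<and> y \<notin> f ` S"
    using tgt
  proof
    assume t: "target a < l \<and> target w = Suc (target a)"
    let ?N = "{z \<in> A (target w). E (f a) z}"
    have "D \<le> card ?N" using host fa t by (auto simp: level_host_def)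
    moreover have "card (f ` S) < D"
      using card_image_le[OF finS, of f] card_mono[OF finite_VH S] D by linarith
    ultimately have "\<not> ?N \<subseteq> f ` S" using finS card_mono[of "f ` S" ?N] by auto
    then show ?thesis by auto
  next
    assume t: "target a = l \<and> target w = l - 1"
    then have "f a \<in> A l" using fa by simp
    from back_path[OF this S, of f] obtain ys where ys: "ys ! l = f a"
      "\<And>i. i < l \<Longrightarrow> E (ys ! i) (ys ! Suc i)" "\<And>i. i \<le> l \<Longrightarrow> ys ! i \<in> A i"
      "\<And>i. 0 < i \<Longrightarrow> i < l \<Longrightarrow> ys ! i \<notin> f ` S" by metis
    then show ?thesis
      using ys(2)[of "l - 1"] ys(3)[of "l - 1"] ys(4)[of "l - 1"] l_ge_2 t E_sym
      by (intro exI[of _ "ys ! (l - 1)"]) auto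
  qed
  then obtain y where y: "y \<in> A (target w)" "E (f a) y" "y \<notin> f ` S" by blast
  have ww: "\<not> R w w" using lev_step[of w w] by auto
  have "embeds E A (insert w S) (f(w := y))"
    unfolding embeds_def
  proof (intro conjI ballI impI)
    show "inj_on (f(w := y)) (insert w S)"
      using f y(3) w by (auto simp: embeds_def inj_on_def)
  next
    fix b c assume "b \<in> insert w S" "c \<in> insert w S" "R b c"
    then show "E ((f(w := y)) b) ((f(w := y)) c)"
      using f y(2) w only[of b] only[of c] ww E_sym R_sym by (auto simp: embeds_def)
  next
    fix b assume "b \<in> insert w S"
    then show "(f(w := y)) b \<in> A (target b)" using f y(1) by (auto simp: embeds_def)
  qed
  then show ?thesis by blast
qed

text \<open>The chain between \<open>v\<close> and \<open>a\<close> is laid out at once on the inner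
  vertices of a fresh back path from \<open>x = f v\<close> to \<open>f a\<close>. It is not built
  vertex by vertex, because a host controls the ways down to \<open>x\<close> only as whole
  paths.\<close>

lemma embed_chain:
  assumes f: "embeds E A S f" and S: "S \<subseteq> VH" "v \<in> S" and a: "a \<in> S" "target a = l"
    and c: "\<And>i. 0 < i \<Longrightarrow> i < l \<Longrightarrow> c i \<in> VH - S \<and> lev (c i) = i"
    and only: "\<And>i b. 0 < i \<Longrightarrow> i < l \<Longrightarrow> b \<in> S \<Longrightarrow> R (c i) b \<Longrightarrow> i = 1 \<and> b = v \<or> i = l - 1 \<and> b = a"
  shows "\<exists>f'. embeds E A (S \<union> c ` {0<..<l}) f'"
proof -
  have "f a \<in> A l" using f a by (auto simp: embeds_def)
  from back_path[OF this S(1), of f] obtain ys where ys: "length ys = Suc l" "distinct ys" "ys ! l = f a"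
    "\<And>i. i < l \<Longrightarrow> E (ys ! i) (ys ! Suc i)" "\<And>i. i \<le> l \<Longrightarrow> ys ! i \<in> A i"
    "\<And>i. 0 < i \<Longrightarrow> i < l \<Longrightarrow> ys ! i \<notin> f ` S" by metis
  define g where "g u = (if u \<in> S then f u else ys ! lev u)" for u
  have gS: "g u = f u" if "u \<in> S" for u using that by (simp add: g_def)
  have gc: "g (c i) = ys ! i" if "0 < i" "i < l" for i using c[OF that] by (simp add: g_def)
  have "f v \<in> A 0" using f S(2) lev_v by (force simp: embeds_def target_def)
  then have fv: "f v = ys ! 0" using ys(5)[of 0] A_0 by simp
  have edge: "E (g (c i)) (g b)" if i: "0 < i" "i < l" and b: "b \<in> S \<union> c ` {0<..<l}" and R: "R (c i) b" for i b
  proof (cases "b \<in> S")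
    case True
    then consider "i = 1" "b = v" | "i = l - 1" "b = a" using only[OF i _ R] by blast
    then show ?thesis
    proof cases
      case 1
      then show ?thesis using gc[OF i] gS[OF True] fv ys(4)[of 0] i E_sym by simp
    next
      case 2
      then show ?thesis using gc[OF i] gS[OF True] ys(3) ys(4)[of i] i by simp
    qed
  next
    case False
    then obtain j where j: "0 < j" "j < l" "b = c j" using b by auto
    then have "i = Suc j \<or> j = Suc i" using lev_step[OF R] c[OF i] c[OF j(1,2)] by simp
    then show ?thesis
    proof
      assume "i = Suc j"
      then show ?thesis using gc[OF i] gc[OF j(1,2)] j ys(4)[of j] E_sym by simp
    next
      assume "j = Suc i"
      then show ?thesis using gc[OF i] gc[OF j(1,2)] j ys(4)[of i] i by simp
    qed
  qed
  have "embeds E A (S \<union> c ` {0<..<l}) g"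
    unfolding embeds_def
  proof (intro conjI ballI impI)
    show "inj_on g (S \<union> c ` {0<..<l})"
    proof (rule inj_onI)
      fix p q assume pq: "p \<in> S \<union> c ` {0<..<l}" "q \<in> S \<union> c ` {0<..<l}" "g p = g q"
      have new: "g (c i) \<noteq> g u" if "0 < i" "i < l" "u \<in> S" for i u
      proof -
        have "g (c i) \<notin> f ` S" using gc[OF that(1,2)] ys(6)[OF that(1,2)] by simp
        then show ?thesis using gS[OF that(3)] that(3) by auto
      qed
      show "p = q"
      proof (cases "p \<in> S"; cases "q \<in> S")
        assume "p \<in> S" "q \<in> S"
        then show ?thesis using pq f gS by (auto simp: embeds_def inj_on_def)
      next
        assume "p \<notin> S" "q \<notin> S"
        then obtain i j where "0 < i" "i < l" "0 < j" "j < l" "p = c i" "q = c j" using pq by auto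
        then show ?thesis using pq(3) gc ys(1,2) by (auto simp: nth_eq_iff_index_eq)
      next
        assume "p \<in> S" "q \<notin> S"
        then obtain j where "0 < j" "j < l" "q = c j" using pq by auto
        then show ?thesis using new[of j p] \<open>p \<in> S\<close> pq(3) by simp
      next
        assume "p \<notin> S" "q \<in> S"
        then obtain i where "0 < i" "i < l" "p = c i" using pq by auto
        then show ?thesis using new[of i q] \<open>q \<in> S\<close> pq(3) by simp
      qed
    qed
  next
    fix p q assume pq: "p \<in> S \<union> c ` {0<..<l}" "q \<in> S \<union> c ` {0<..<l}" "R p q"
    show "E (g p) (g q)"
    proof (cases "p \<in> S \<and> q \<in> S")
      case True
      then show ?thesis using f gS pq(3) by (auto simp: embeds_def)
    next
      case False
      then consider i where "0 < i" "i < l" "p = c i" | i where "0 < i" "i < l" "q = c i"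
        using pq(1,2) by auto
      then show ?thesis
      proof cases
        case 1
        then show ?thesis using edge[of i q] pq by simp
      next
        case 2
        then show ?thesis using edge[of i p] pq R_sym E_sym by simp
      qed
    qed
  next
    fix p assume p: "p \<in> S \<union> c ` {0<..<l}"
    show "g p \<in> A (target p)"
    proof (cases "p \<in> S")
      case True
      then show ?thesis using f gS by (auto simp: embeds_def)
    next
      case False
      then obtain i where i: "0 < i" "i < l" "p = c i" using p by auto
      then have "target p = i" using c[of i] by (simp add: target_def)
      then show ?thesis using gc[of i] ys(5)[of i] i by simp
    qed
  qed
  then show ?thesis by blast
qed

text \<open>Only when the edge from \<open>a\<close> to \<open>w\<close> descends from level
  \<open>l\<close> to \<open>l - 1\<close> is a whole chain from \<open>w\<close> down to
  \<open>v\<close> added. Descents from levels below \<open>l\<close> are excluded by closedness,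
  and every other edge is covered by \<open>target_step\<close>.\<close>

lemma extend_in_component:
  assumes S: "closed S" and f: "embeds E A S f" and w: "w \<notin> S" and a: "R w a" "a \<in> S" "a \<noteq> v"
  shows "\<exists>S' f'. S \<subset> S' \<and> closed S' \<and> embeds E A S' f'"
proof -
  have SV: "v \<in> S" "S \<subseteq> VH" and low: "\<And>a b. a \<in> S \<Longrightarrow> lev a < l \<Longrightarrow> R a b \<Longrightarrow> lev b < lev a \<Longrightarrow> b \<in> S"
    using S by (auto simp: closed_def)
  have wV: "w \<in> VH" and wv: "w \<noteq> v" using R_in a w SV by auto
  have only: "b = a" if "b \<in> S" "R w b" "b \<noteq> v" for b
    by (rule unique_attachment[OF S w a _ _ _ _ conn_refl]) (use that in auto)
  have adj_v: "lev w = 1" if "R w v" using lev_step[OF that] lev_v by simp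
  have a0: "0 < lev a" using a R_in2 lev_0 by blast
  show ?thesis
  proof (cases "lev w = l - 1 \<and> lev a = l")
    case False
    have up: "l \<le> lev w \<or> lev w = Suc (lev a)"
    proof (rule ccontr)
      assume "\<not> ?thesis"
      then have la: "lev w < l" "lev a = Suc (lev w)" using lev_step[OF a(1)] by auto
      then have "lev a < l" using False by linarith
      then show False using la low[OF a(2) _ R_sym[OF a(1)]] w by simp
    qed
    \<comment> \<open>Hence \<open>w\<close> is not adjacent to \<open>v\<close>, and
      \<open>a\<close> is its only old neighbour.\<close>
    then have "lev w \<noteq> 1" using a0 l_ge_2 by auto
    then have only': "b = a" if "b \<in> S" "R w b" for b using only that adj_v by blast
    obtain f' where "embeds E A (insert w S) f'"
      using embed_vertex[OF f SV(2) _ a(2) _ only' target_step[OF _ up]] wV w a(1) R_sym by blast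
    moreover have "closed (insert w S)"
    proof (rule closed_extend[OF S])
      fix u b assume u: "u \<in> insert w S - S" "lev u < l" "R u b" "lev b < lev u"
      then have uw: "u = w" by (metis DiffE insertE)
      then have "b = a" using unique_lower[OF u(3), of a] u a(1) up by auto
      then show "b \<in> insert w S" using a by simp
    next
      fix u assume "u \<in> insert w S - S"
      then show "(u, a) \<in> conn (insert w S - {v})" using a wv by (auto intro!: conn_edge)
    qed (use a wV SV in auto)
    ultimately show ?thesis using w by blast
  next
    case True
    obtain c where c: "c 0 = v" "c (lev w) = w" "\<And>i. i \<le> lev w \<Longrightarrow> c i \<in> VH \<and> lev (c i) = i"
      "\<And>i. i < lev w \<Longrightarrow> R (c i) (c (Suc i))"
      using chain_exists[OF wV] by blast
    have lw: "lev w = l - 1" using True by simp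
    have cv: "c i \<noteq> v" if "0 < i" "i < l" for i
    proof
      assume "c i = v"
      then have "lev (c i) = 0" using lev_v by simp
      then show False using c(3)[of i] that lw by simp
    qed
    have path: "(c i, c j) \<in> conn (c ` {i..j})" if "i \<le> j" "j < l" for i j
      using that
    proof (induction j rule: dec_induct)
      case base
      show ?case by (rule conn_refl)
    next
      case (step j)
      have "(c i, c j) \<in> conn (c ` {i..Suc j})"
        by (rule conn_mono[OF _ step.IH]) (use step in auto)
      moreover have "(c j, c (Suc j)) \<in> conn (c ` {i..Suc j})"
        by (rule conn_edge) (use c(4)[of j] step lw in auto)
      ultimately show ?case by (rule conn_trans)
    qed
    \<comment> \<open>The chain below \<open>w\<close> is joined to \<open>c (l - 2)\<close> around
      \<open>v\<close> and \<open>w\<close>. An old vertex on this part of the chain, or an old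
      neighbour of it other than \<open>v\<close>, would force \<open>c (l - 2) = a\<close> by
      \<open>unique_attachment\<close>, which the levels forbid.\<close>
    have below: "(c (l - 2), c i) \<in> conn (VH - {v, w})" if i: "0 < i" "i < l - 1" for i
    proof (rule conn_sym, rule conn_mono[OF _ path])
      show "c ` {i..l - 2} \<subseteq> VH - {v, w}"
      proof
        fix u assume "u \<in> c ` {i..l - 2}"
        then obtain j where j: "i \<le> j" "j \<le> l - 2" "u = c j" by auto
        then have "lev u = j" "u \<in> VH" using c(3)[of j] lw i by auto
        then show "u \<in> VH - {v, w}" using j i lw l_ge_2 lev_v by auto
      qed
    qed (use i in auto)
    have ca: "c (l - 2) \<noteq> a"
    proof
      assume eq: "c (l - 2) = a"
      have "l - 2 \<le> lev w" using lw by linarith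
      then have "lev (c (l - 2)) = l - 2" using c(3) by blast
      then show False using eq True l_ge_2 by simp
    qed
    have wc: "R w (c (l - 2))" if "2 < l"
    proof -
      have "R (c (l - 2)) (c (Suc (l - 2)))" by (rule c(4)) (use lw that in linarith)
      moreover have "Suc (l - 2) = lev w" using lw that by linarith
      ultimately show ?thesis using c(2) R_sym by simp
    qed
    have cS: "c i \<notin> S" if i: "0 < i" "i < l" for i
    proof
      assume iS: "c i \<in> S"
      show False
      proof (cases "i = l - 1")
        case True
        then show False using c(2) lw iS w by simp
      next
        case False
        then have "c (l - 2) = a"
          using unique_attachment[OF S w a wc cv iS cv below] i by auto
        then show False using ca by simp
      qed
    qed
    have edges: "i = 1 \<and> b = v \<or> i = l - 1 \<and> b = a" if i: "0 < i" "i < l" and b: "b \<in> S" "R (c i) b" for i b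
    proof (cases "b = v")
      case True
      then show ?thesis using lev_step[OF b(2)] lev_v c(3)[of i] lw i by auto
    next
      case bv: False
      show ?thesis
      proof (cases "i = l - 1")
        case True
        then show ?thesis using only[of b] b bv c(2) lw by simp
      next
        case False
        have "(c (l - 2), c i) \<in> conn (VH - {v, w})" using below[of i] i False by simp
        moreover have "(c i, b) \<in> conn (VH - {v, w})"
        proof (rule conn_edge[OF b(2)])
          have "i \<le> lev w" using i lw by linarith
          then have "c i \<in> VH" "lev (c i) = i" using c(3) by blast+
          then show "c i \<in> VH - {v, w}" using cv[OF i] lw False by auto
          show "b \<in> VH - {v, w}" using b bv w SV by auto
        qed
        ultimately have "(c (l - 2), b) \<in> conn (VH - {v, w})" by (rule conn_trans)
        then have "c (l - 2) = a"
          using unique_attachment[OF S w a wc cv b(1) bv] i False by auto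
        then show ?thesis using ca by simp
      qed
    qed
    let ?S' = "S \<union> c ` {0<..<l}"
    have ta: "target a = l" using True by (simp add: target_def)
    have cV: "c i \<in> VH - S \<and> lev (c i) = i" if "0 < i" "i < l" for i
      using cS[OF that] c(3)[of i] that lw by auto
    obtain f' where "embeds E A ?S' f'"
      using embed_chain[OF f SV(2,1) a(2) ta cV edges] by blast
    moreover have "closed ?S'"
    proof (rule closed_extend[OF S])
      show "?S' \<subseteq> VH" using SV c(3) lw by auto
    next
      fix u b assume u: "u \<in> ?S' - S" "lev u < l" "R u b" "lev b < lev u"
      then obtain i where i: "0 < i" "i < l" "u = c i" by auto
      have "R (c i) (c (i - 1))" using c(4)[of "i - 1"] i lw R_sym by auto
      moreover have "lev (c (i - 1)) < lev (c i)" using c(3)[of i] c(3)[of "i - 1"] i lw by auto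
      ultimately have "b = c (i - 1)" using unique_lower[OF u(3), of "c (i - 1)"] u i by simp
      then show "b \<in> ?S'" using i c(1) SV by (cases "i = 1") auto
    next
      fix u assume "u \<in> ?S' - S"
      then obtain i where i: "0 < i" "i < l" "u = c i" by auto
      have "(u, w) \<in> conn (c ` {i..l - 1})" using path[of i "l - 1"] i c(2) lw by simp
      moreover have "c ` {i..l - 1} \<subseteq> ?S' - {v}"
      proof
        fix p assume "p \<in> c ` {i..l - 1}"
        then obtain j where j: "p = c j" "0 < j" "j < l" using i by force
        then show "p \<in> ?S' - {v}" using cv[of j] by simp
      qed
      ultimately have "(u, w) \<in> conn (?S' - {v})" using conn_mono by blast
      moreover have "(w, a) \<in> conn (?S' - {v})"
      proof (rule conn_edge[OF a(1)])
        have "w \<in> c ` {0<..<l}" using c(2) lw l_ge_2 by (intro image_eqI[of _ _ "l - 1"]) auto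
        then show "w \<in> ?S' - {v}" using wv by simp
      qed (use a in simp)
      ultimately show "(u, a) \<in> conn (?S' - {v})" by (rule conn_trans)
    qed (use a in auto)
    moreover have "S \<subset> ?S'" using cS[of 1] l_ge_2 by auto
    ultimately show ?thesis by blast
  qed
qed

text \<open>A new vertex of minimal level has its lower neighbours in \<open>S\<close>; by
  \<open>none\<close> such a neighbour is \<open>v\<close>, so the vertex has level 1 and is placed
  on a free neighbour of \<open>x\<close>. It starts a component of the forest that does not meet
  \<open>S\<close>.\<close>

lemma extend_new_component:
  assumes S: "closed S" "S \<noteq> VH" and f: "embeds E A S f"
    and none: "\<And>w a. w \<notin> S \<Longrightarrow> R w a \<Longrightarrow> a \<in> S \<Longrightarrow> a = v"
  shows "\<exists>S' f'. S \<subset> S' \<and> closed S' \<and> embeds E A S' f'"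
proof -
  have SV: "v \<in> S" "S \<subseteq> VH" using S by (auto simp: closed_def)
  then obtain u where u: "u \<in> VH" "u \<notin> S" using S(2) by blast
  define w where "w = arg_min lev (\<lambda>w. w \<in> VH \<and> w \<notin> S)"
  have w: "w \<in> VH" "w \<notin> S"
    using arg_min_natI[of "\<lambda>w. w \<in> VH \<and> w \<notin> S" u lev] u by (auto simp: w_def)
  have min: "lev w \<le> lev b" if "b \<in> VH" "b \<notin> S" for b
    unfolding w_def by (rule arg_min_nat_le) (use that in auto)
  have wv: "w \<noteq> v" using w SV by auto
  obtain b where b: "R w b" "lev b < lev w" using lower[OF w(1) wv] by blast
  then have "b \<in> S" using min[of b] R_in2 by force
  then have bv: "b = v" using none w b by blast
  then have lw: "lev w = 1" using lev_step[OF b(1)] lev_v by auto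
  have "target v < l \<and> target w = Suc (target v)"
    using lev_v lw l_ge_2 by (simp add: target_def)
  then obtain f' where "embeds E A (insert w S) f'"
    using embed_vertex[OF f SV(2) _ SV(1), of w] w b bv none R_sym by blast
  moreover have "closed (insert w S)"
  proof -
    have iso: "q \<notin> S" if "(w, q) \<in> conn (VH - {v})" for q
      using that unfolding conn_def
    proof (induction rule: rtrancl_induct)
      case base
      show ?case using w by simp
    next
      case (step y z)
      then show ?case using none[of y z] by auto
    qed
    have iso': "(w, q) \<notin> conn (VH - {v})" "(q, w) \<notin> conn (VH - {v})" if "q \<in> S" for q
      using that iso conn_sym by blast+
    have "(p, q) \<in> conn (insert w S - {v})"
      if "p \<in> insert w S - {v}" "q \<in> insert w S - {v}" "(p, q) \<in> conn (VH - {v})" for p q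
    proof (cases "p = w \<or> q = w")
      case True
      then have "p = q" using that iso' by auto
      then show ?thesis using conn_refl by simp
    next
      case False
      then have "(p, q) \<in> conn (S - {v})" using that S(1) by (auto simp: closed_def)
      then show ?thesis by (rule conn_mono[rotated]) auto
    qed
    moreover have "c \<in> S" if "R w c" "lev c < lev w" for c
      using that lw lev_0[of c] R_in2 SV by auto
    ultimately show ?thesis using S(1) w unfolding closed_def by blast
  qed
  ultimately show ?thesis using w by blast
qed

lemma embedding_exists: "\<exists>f. embeds E A VH f"
proof -
  have "\<exists>f. embeds E A VH f" if "closed S" "embeds E A S f" for S f
    using that
  proof (induction "card (VH - S)" arbitrary: S f rule: less_induct)
    case less
    show ?case
    proof (cases "S = VH")
      case True
      then show ?thesis using less by blast
    next
      case False
      obtain S' f' where S': "S \<subset> S'" "closed S'" "embeds E A S' f'"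
      proof (cases "\<exists>w a. w \<notin> S \<and> R w a \<and> a \<in> S \<and> a \<noteq> v")
        case True
        then show ?thesis using extend_in_component[OF less.prems] that by blast
      next
        case none: False
        then show ?thesis using extend_new_component[OF less.prems(1) False less.prems(2)] that by blast
      qed
      then have "VH - S' \<subset> VH - S" unfolding closed_def by blast
      then have "card (VH - S') < card (VH - S)" using finite_VH by (intro psubset_card_mono) auto
      then show ?thesis using less.hyps S' by blast
    qed
  qed
  moreover have "closed {v}" using v_in lev_v by (auto simp: closed_def)
  moreover have "embeds E A {v} (\<lambda>_. x)"
    using A_0 lev_v lev_step[of v v] by (auto simp: embeds_def target_def)
  ultimately show ?thesis by blast
qed

end

end

section \<open>Extremal numbers\<close>

text \<open>Take a smallest vertex set spanning more than \<open>d\<close> edges per vertex.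
  Deleting a vertex of degree below \<open>d\<close> would preserve that density.\<close>

lemma min_degree_subgraph:
  fixes d :: real
  assumes G: "simple_graph G" and dense: "d * real (card (verts G)) < real (card (edges G))"
  shows "\<exists>U\<subseteq>verts G. U \<noteq> {} \<and> (\<forall>v\<in>U. d \<le> real (card {u \<in> U. {u, v} \<in> edges G}))"
proof -
  have sub: "e \<subseteq> verts G \<and> card e = 2" if "e \<in> edges G" for e
    using G that by (auto simp: simple_graph_def)
  have finV: "finite (verts G)" using G by (simp add: simple_graph_def)
  have finE: "finite (edges G)"
    by (rule finite_subset[of _ "Pow (verts G)"]) (use sub finV in auto)
  define inside where "inside U = {e \<in> edges G. e \<subseteq> U}" for U
  define P where "P U \<longleftrightarrow> U \<subseteq> verts G \<and> d * real (card U) < real (card (inside U))" for U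
  define U where "U = arg_min card P"
  have "inside (verts G) = edges G" using sub by (auto simp: inside_def)
  then have "P (verts G)" using dense by (simp add: P_def)
  then have U: "P U" unfolding U_def by (rule arg_min_natI)
  have min: "card U \<le> card U'" if "P U'" for U'
    unfolding U_def using that by (rule arg_min_nat_le)
  have finU: "finite U" using U finV finite_subset by (auto simp: P_def)
  have "inside {} = {}" using sub by (force simp: inside_def)
  then have "U \<noteq> {}" using U by (auto simp: P_def)
  moreover have "d \<le> real (card {u \<in> U. {u, v} \<in> edges G})" if v: "v \<in> U" for v
  proof (rule ccontr)
    assume low: "\<not> ?thesis"
    let ?N = "{u \<in> U. {u, v} \<in> edges G}"
    have cover: "inside U \<subseteq> inside (U - {v}) \<union> (\<lambda>u. {u, v}) ` ?N"
    proof
      fix e assume e: "e \<in> inside U"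
      show "e \<in> inside (U - {v}) \<union> (\<lambda>u. {u, v}) ` ?N"
      proof (cases "v \<in> e")
        case True
        have "card e = 2" using e sub by (auto simp: inside_def)
        then obtain a b where "e = {a, b}" by (auto simp: card_2_iff)
        then obtain u where "e = {u, v}" using True by (metis doubleton_eq_iff insertE singletonD)
        then show ?thesis using e by (auto simp: inside_def)
      qed (use e in \<open>auto simp: inside_def\<close>)
    qed
    have "finite (inside (U - {v}))" using finE by (simp add: inside_def)
    then have "card (inside U) \<le> card (inside (U - {v}) \<union> (\<lambda>u. {u, v}) ` ?N)"
      using cover finU by (intro card_mono) auto
    also have "\<dots> \<le> card (inside (U - {v})) + card ((\<lambda>u. {u, v}) ` ?N)" by (rule card_Un_le)
    also have "card ((\<lambda>u. {u, v}) ` ?N) \<le> card ?N" using finU by (intro card_image_le) auto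
    finally have "real (card (inside U)) \<le> real (card (inside (U - {v}))) + real (card ?N)" by simp
    moreover have cU: "card U = Suc (card (U - {v}))" using v finU card_Suc_Diff1[of U v] by simp
    then have "d * real (card U) = d * real (card (U - {v})) + d" by (simp add: algebra_simps)
    ultimately have "P (U - {v})" using U low by (auto simp: P_def)
    then show False using min[of "U - {v}"] cU by simp
  qed
  ultimately show ?thesis using U by (auto simp: P_def)
qed

section \<open>Walks, paths and cycles\<close>

lemma walk_to_path:
  assumes "is_walk G xs"
  shows "\<exists>ys. is_walk G ys \<and> distinct ys \<and> hd ys = hd xs \<and> last ys = last xs \<and>
    set ys \<subseteq> set xs \<and> length ys \<le> length xs"
  using assms
proof (induction xs)
  case Nil
  then show ?case by (simp add: is_walk_def)
next
  case (Cons x xs)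
  show ?case
  proof (cases "xs = []")
    case True
    then show ?thesis using Cons.prems by (intro exI[of _ "[x]"]) auto
  next
    case False
    then have "is_walk G xs" and e: "{x, hd xs} \<in> edges G" "x \<in> verts G"
      using Cons.prems by (auto simp: is_walk_def successively_Cons)
    then obtain ys where ys: "is_walk G ys" "distinct ys" "hd ys = hd xs" "last ys = last xs"
      "set ys \<subseteq> set xs" "length ys \<le> length xs" using Cons.IH by blast
    then have "ys \<noteq> []" by (auto simp: is_walk_def)
    show ?thesis
    proof (cases "x \<in> set ys")
      case True
      then obtain as bs where s: "ys = as @ x # bs" by (auto simp: in_set_conv_decomp)
      have "is_walk G (x # bs)" using ys(1) by (auto simp: is_walk_def s successively_append_iff)
      then show ?thesis using ys s False by (intro exI[of _ "x # bs"]) auto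
    next
      case False
      then show ?thesis using ys e \<open>ys \<noteq> []\<close> \<open>xs \<noteq> []\<close>
        by (intro exI[of _ "x # ys"]) (auto simp: is_walk_def successively_Cons)
    qed
  qed
qed

text \<open>Shorten the walk to a path, which still has at least two vertices, and close it with
  \<open>w\<close>.\<close>

lemma cycle_of_walk:
  assumes xs: "is_walk G xs" "hd xs \<noteq> last xs" and w: "w \<in> verts G" "w \<notin> set xs"
    "{w, hd xs} \<in> edges G" "{w, last xs} \<in> edges G"
  shows "\<exists>c. is_cycle G c \<and> length c \<le> Suc (length xs)"
proof -
  obtain ys where ys: "is_walk G ys" "distinct ys" "hd ys = hd xs" "last ys = last xs"
    "set ys \<subseteq> set xs" "length ys \<le> length xs" using walk_to_path[OF xs(1)] by blast
  have "2 \<le> length ys"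
    using ys(1,3,4) xs(2) by (cases ys; cases "tl ys") (auto simp: is_walk_def)
  moreover from this have "ys \<noteq> []" by auto
  ultimately have "is_cycle G (w # ys)"
    using ys w by (auto simp: is_cycle_def is_walk_def successively_Cons insert_commute)
  then show ?thesis using ys(6) by (intro exI[of _ "w # ys"]) simp
qed

lemma contains_copy_of_embedding:
  assumes H: "simple_graph H" and f: "inj_on f (verts H)" "f ` verts H \<subseteq> verts G"
    and e: "\<And>a b. {a, b} \<in> edges H \<Longrightarrow> {f a, f b} \<in> edges G"
  shows "contains_copy G H"
proof -
  define F where "F = \<lparr>verts = f ` verts H, edges = image f ` edges H\<rparr>"
  have H': "finite (verts H)" "\<And>e. e \<in> edges H \<Longrightarrow> e \<subseteq> verts H \<and> card e = 2"
    using H by (auto simp: simple_graph_def)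
  have "is_subgraph F G"
    unfolding is_subgraph_def
  proof (intro conjI)
    have "card (f ` e) = 2" if "e \<in> edges H" for e
      using H'(2)[OF that] card_image[OF inj_on_subset[OF f(1)], of e] by simp
    then show "simple_graph F"
      using H' by (auto simp: simple_graph_def F_def)
    show "verts F \<subseteq> verts G" using f(2) by (simp add: F_def)
    show "edges F \<subseteq> edges G"
    proof
      fix e' assume "e' \<in> edges F"
      then obtain a where a: "a \<in> edges H" "e' = f ` a" by (auto simp: F_def)
      then obtain u v where "a = {u, v}" using H'(2) by (metis card_2_iff)
      then show "e' \<in> edges G" using a e[of u v] by simp
    qed
  qed
  moreover have "graph_iso H F"
    unfolding graph_iso_def
  proof (intro exI[of _ f] conjI ballI)
    show "bij_betw f (verts H) (verts F)" using f(1) by (simp add: F_def bij_betw_def)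
    fix u v assume uv: "u \<in> verts H" "v \<in> verts H"
    show "{u, v} \<in> edges H \<longleftrightarrow> {f u, f v} \<in> edges F"
    proof
      assume "{u, v} \<in> edges H"
      then have "f ` {u, v} \<in> edges F" unfolding F_def by (metis image_eqI ugraph.select_convs(2))
      then show "{f u, f v} \<in> edges F" by simp
    next
      assume "{f u, f v} \<in> edges F"
      then obtain a where a: "a \<in> edges H" "f ` {u, v} = f ` a" by (auto simp: F_def)
      then have "{u, v} = a" using f(1) H'(2)[of a] uv by (subst (asm) inj_on_image_eq_iff) auto
      then show "{u, v} \<in> edges H" using a by simp
    qed
  qed
  ultimately show ?thesis by (auto simp: contains_copy_def)
qed

section \<open>Grading a graph by distance\<close>

definition dist_from :: "'a ugraph \<Rightarrow> 'a \<Rightarrow> 'a \<Rightarrow> nat" where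
  "dist_from H v w = (LEAST n. \<exists>xs. is_walk H xs \<and> hd xs = v \<and> last xs = w \<and> length xs = Suc n)"

text \<open>Distances count edges while the length of a list counts vertices, hence the strict
  inequality.\<close>

lemma dist_from_le:
  assumes "is_walk H xs" "hd xs = v" "last xs = w"
  shows "dist_from H v w < length xs"
proof -
  have "length xs = Suc (length xs - 1)" using assms by (cases xs) (auto simp: is_walk_def)
  then have "dist_from H v w \<le> length xs - 1"
    unfolding dist_from_def by (intro Least_le) (use assms in blast)
  then show ?thesis using \<open>length xs = Suc (length xs - 1)\<close> by linarith
qed

lemma shortest_walk:
  assumes "connected_graph H" "v \<in> verts H" "w \<in> verts H"
  shows "\<exists>xs. is_walk H xs \<and> hd xs = v \<and> last xs = w \<and> length xs = Suc (dist_from H v w)"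
proof -
  obtain xs where xs: "is_walk H xs" "hd xs = v" "last xs = w"
    using assms unfolding connected_graph_def by blast
  moreover from this have "length xs = Suc (length xs - 1)" by (cases xs) (auto simp: is_walk_def)
  ultimately have "\<exists>n. \<exists>xs. is_walk H xs \<and> hd xs = v \<and> last xs = w \<and> length xs = Suc n"
    by (intro exI[of _ "length xs - 1"] exI[of _ xs] conjI)
  then show ?thesis
    unfolding dist_from_def by (rule LeastI_ex)
qed

lemma dist_from_walk_vertex:
  assumes xs: "is_walk H xs" "hd xs = v" and u: "u \<in> set xs"
  shows "dist_from H v u < length xs"
proof -
  obtain as bs where s: "xs = as @ u # bs" using u by (auto simp: in_set_conv_decomp)
  have "is_walk H (as @ [u])"
    using xs(1) by (auto simp: is_walk_def s successively_append_iff)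
  moreover have "hd (as @ [u]) = v" using xs(2) by (cases as) (auto simp: s)
  ultimately have "dist_from H v u < length (as @ [u])" by (intro dist_from_le) auto
  then show ?thesis by (simp add: s)
qed

lemma dist_from_step_le:
  assumes H: "connected_graph H" "v \<in> verts H" and ab: "{a, b} \<in> edges H" "a \<in> verts H" "b \<in> verts H"
  shows "dist_from H v b \<le> Suc (dist_from H v a)"
proof -
  obtain xs where xs: "is_walk H xs" "hd xs = v" "last xs = a" "length xs = Suc (dist_from H v a)"
    using shortest_walk[OF H ab(2)] by blast
  then have "is_walk H (xs @ [b])" "hd (xs @ [b]) = v"
    using ab by (auto simp: is_walk_def successively_append_iff)
  then have "dist_from H v b < length (xs @ [b])" by (intro dist_from_le) auto
  then show ?thesis using xs(4) by simp
qed

lemma walk_parity: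
  assumes "A \<inter> B = {}" "\<forall>e\<in>edges H. \<exists>a\<in>A. \<exists>b\<in>B. e = {a, b}" "is_walk H xs"
  shows "(hd xs \<in> A \<longleftrightarrow> last xs \<in> A) \<longleftrightarrow> odd (length xs)"
  using assms(3)
proof (induction xs)
  case Nil
  then show ?case by (simp add: is_walk_def)
next
  case (Cons x xs)
  show ?case
  proof (cases "xs = []")
    case False
    then have w: "is_walk H xs" "{x, hd xs} \<in> edges H"
      using Cons.prems by (auto simp: is_walk_def successively_Cons)
    obtain p q where "p \<in> A" "q \<in> B" "{x, hd xs} = {p, q}" using assms(2) w(2) by blast
    then have "x \<in> A \<longleftrightarrow> hd xs \<notin> A" using assms(1) by (auto simp: doubleton_eq_iff)
    then show ?thesis using Cons.IH[OF w(1)] False by auto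
  qed simp
qed

text \<open>Bipartiteness gives \<open>lev_step\<close>: equal distances at the ends of an edge
  contradict parity. The girth gives \<open>unique_lower\<close>, and the feedback vertex gives
  \<open>forest\<close>.\<close>

lemma levelled_forest_of_graph:
  assumes H: "simple_graph H" "connected_graph H" "bipartite_graph H" and v: "v \<in> verts H"
    and fvs: "acyclic_graph (delete_verts H {v})"
    and girth: "\<And>c. is_cycle H c \<Longrightarrow> 2 * k \<le> length c" and l: "2 \<le> l" "l \<le> k"
  shows "levelled_forest (verts H) (\<lambda>a b. {a, b} \<in> edges H) v (dist_from H v) l"
proof -
  have inV: "a \<in> verts H" "b \<in> verts H" "a \<noteq> b" if "{a, b} \<in> edges H" for a b
    using H(1) that by (auto simp: simple_graph_def card_2_iff)
  have dv: "dist_from H v v = 0"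
    using dist_from_le[of H "[v]" v v] v by (simp add: is_walk_def)
  have step: "dist_from H v a = Suc (dist_from H v b) \<or> dist_from H v b = Suc (dist_from H v a)"
    if ab: "{a, b} \<in> edges H" for a b
  proof -
    have ba: "{b, a} \<in> edges H" using ab by (simp add: insert_commute)
    have "dist_from H v b \<le> Suc (dist_from H v a)" "dist_from H v a \<le> Suc (dist_from H v b)"
      using dist_from_step_le[OF H(2) v ab inV(1,2)[OF ab]]
        dist_from_step_le[OF H(2) v ba inV(1,2)[OF ba]] by simp_all
    moreover have "dist_from H v a \<noteq> dist_from H v b"
    proof
      assume eq: "dist_from H v a = dist_from H v b"
      obtain A B where AB: "A \<inter> B = {}" "\<forall>e\<in>edges H. \<exists>a\<in>A. \<exists>b\<in>B. e = {a, b}"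
        using H(3) by (auto simp: bipartite_graph_def)
      obtain xs where "is_walk H xs" "hd xs = v" "last xs = a" "length xs = Suc (dist_from H v a)"
        using shortest_walk[OF H(2) v inV(1)[OF ab]] by blast
      moreover obtain ys where "is_walk H ys" "hd ys = v" "last ys = b" "length ys = Suc (dist_from H v b)"
        using shortest_walk[OF H(2) v inV(2)[OF ab]] by blast
      ultimately have "a \<in> A \<longleftrightarrow> b \<in> A"
        using walk_parity[OF AB, of xs] walk_parity[OF AB, of ys] eq by (simp, blast)
      moreover obtain p q where "p \<in> A" "q \<in> B" "{a, b} = {p, q}" using AB(2) ab by blast
      ultimately show False using AB(1) by (auto simp: doubleton_eq_iff)
    qed
    ultimately show ?thesis by linarith
  qed
  show ?thesis
  proof
    show "finite (verts H)" using H(1) by (simp add: simple_graph_def)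
    show "v \<in> verts H" by (rule v)
    show "2 \<le> l" by (rule l)
    show "dist_from H v v = 0" by (rule dv)
  next
    fix a b assume "{a, b} \<in> edges H"
    then show "{b, a} \<in> edges H" "a \<in> verts H" using inV by (auto simp: insert_commute)
  next
    fix a b assume "{a, b} \<in> edges H"
    then show "dist_from H v a = Suc (dist_from H v b) \<or> dist_from H v b = Suc (dist_from H v a)"
      by (rule step)
  next
    fix a assume a: "a \<in> verts H" "dist_from H v a = 0"
    then obtain xs where "is_walk H xs" "hd xs = v" "last xs = a" "length xs = 1"
      using shortest_walk[OF H(2) v] by fastforce
    then show "a = v" by (cases xs) auto
  next
    fix a assume a: "a \<in> verts H" "a \<noteq> v"
    obtain xs where xs: "is_walk H xs" "hd xs = v" "last xs = a" "length xs = Suc (dist_from H v a)"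
      using shortest_walk[OF H(2) v a(1)] by blast
    obtain ys where ys: "xs = ys @ [a]" using xs by (cases xs rule: rev_cases) (auto simp: is_walk_def)
    have "ys \<noteq> []" using xs(2) ys a(2) by auto
    then have "is_walk H ys" "hd ys = v" "{last ys, a} \<in> edges H"
      using xs ys by (auto simp: is_walk_def successively_append_iff)
    moreover from this have "dist_from H v (last ys) < length ys" by (intro dist_from_le) auto
    ultimately show "\<exists>b. {a, b} \<in> edges H \<and> dist_from H v b < dist_from H v a"
      using xs(4) ys by (intro exI[of _ "last ys"]) (auto simp: insert_commute)
  next
    fix a b c
    assume ab: "{a, b} \<in> edges H" and ac: "{a, c} \<in> edges H"
      and lt: "dist_from H v b < dist_from H v a" "dist_from H v c < dist_from H v a" "dist_from H v a < l"
    show "b = c"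
    proof (rule ccontr)
      assume "b \<noteq> c"
      obtain xs where xs: "is_walk H xs" "hd xs = v" "last xs = b" "length xs = Suc (dist_from H v b)"
        using shortest_walk[OF H(2) v inV(2)[OF ab]] by blast
      obtain ys where ys: "is_walk H ys" "hd ys = v" "last ys = c" "length ys = Suc (dist_from H v c)"
        using shortest_walk[OF H(2) v inV(2)[OF ac]] by blast
      have ne: "xs \<noteq> []" "ys \<noteq> []" using xs ys by (auto simp: is_walk_def)
      obtain ys' where ys': "ys = v # ys'" using ne ys(2) by (cases ys) auto
      let ?w = "rev xs @ ys'"
      have "successively (\<lambda>u v. {u, v} \<in> edges H) (rev xs)"
        using xs(1) by (simp add: is_walk_def successively_rev insert_commute)
      moreover have "last (rev xs) = v" using ne xs(2) by (simp add: last_rev)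
      ultimately have "is_walk H ?w"
        using xs ys by (auto simp: is_walk_def ys' successively_append_iff successively_Cons)
      moreover have "hd ?w = b" using ne xs(3) by (simp add: hd_rev)
      moreover have "last ?w = c" using ne ys(2,3) xs(2) ys' by (cases "ys' = []") (auto simp: last_rev)
      moreover have "a \<notin> set ?w"
        using dist_from_walk_vertex[OF xs(1,2), of a] dist_from_walk_vertex[OF ys(1,2), of a] lt xs(4) ys(4) ys'
        by auto
      ultimately obtain c' where c': "is_cycle H c'" "length c' \<le> Suc (length ?w)"
        using cycle_of_walk[of H ?w a] ab ac inV[OF ab] \<open>b \<noteq> c\<close> by auto
      \<comment> \<open>Both lower neighbours have distance at most \<open>l - 2\<close> from
        \<open>v\<close>, so the cycle has at most \<open>2 * l - 2\<close> vertices.\<close>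
      have "Suc (length ?w) < 2 * k" using xs(4) ys(4) ys' lt l(2) by simp
      then show False using c' girth[OF c'(1)] by linarith
    qed
  next
    fix w a b
    assume w: "w \<noteq> v" "{w, a} \<in> edges H" "{w, b} \<in> edges H" "a \<noteq> v" "b \<noteq> v"
      and r: "(a, b) \<in> {(p, q). {p, q} \<in> edges H \<and> p \<in> verts H - {v, w} \<and> q \<in> verts H - {v, w}}\<^sup>*"
    let ?G = "delete_verts H {v}"
    have edge: "{p, q} \<in> edges ?G" if "{p, q} \<in> edges H" "p \<noteq> v" "q \<noteq> v" for p q
      using that by (auto simp: delete_verts_def)
    have vert: "p \<in> verts ?G \<longleftrightarrow> p \<in> verts H \<and> p \<noteq> v" for p
      by (auto simp: delete_verts_def)
    from r have "\<exists>xs. is_walk ?G xs \<and> hd xs = a \<and> last xs = b \<and> w \<notin> set xs"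
    proof (induction rule: rtrancl_induct)
      case base
      show ?case using w inV[OF w(2)] by (intro exI[of _ "[a]"]) (auto simp: is_walk_def vert)
    next
      case (step y z)
      then obtain xs where "is_walk ?G xs" "hd xs = a" "last xs = y" "w \<notin> set xs" by blast
      then show ?case using step(2) edge
        by (intro exI[of _ "xs @ [z]"]) (auto simp: is_walk_def successively_append_iff vert)
    qed
    then obtain xs where xs: "is_walk ?G xs" "hd xs = a" "last xs = b" "w \<notin> set xs" by blast
    show "a = b"
    proof (rule ccontr)
      assume "a \<noteq> b"
      then have "\<exists>c. is_cycle ?G c"
        using cycle_of_walk[of ?G xs w] xs w edge inV[OF w(2)] vert by auto
      then show False using fvs by (simp add: acyclic_graph_def)
    qed
  qed
qed

section \<open>Feedback vertices, girth and extremal graphs\<close>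

lemma feedback_vertex_number_1:
  assumes H: "simple_graph H" and fvn: "feedback_vertex_number H = 1"
  obtains v c where "v \<in> verts H" "acyclic_graph (delete_verts H {v})" "is_cycle H c"
proof -
  let ?C = "{card S |S. feedback_vertex_set H S}"
  have fin: "finite (verts H)" using H by (simp add: simple_graph_def)
  have "?C \<subseteq> card ` Pow (verts H)" by (auto simp: feedback_vertex_set_def)
  then have finC: "finite ?C" using fin finite_subset by blast
  have "feedback_vertex_set H (verts H)"
    by (auto simp: feedback_vertex_set_def acyclic_graph_def is_cycle_def is_walk_def delete_verts_def)
  then have "?C \<noteq> {}" by blast
  from Min_in[OF finC this] obtain S where S: "feedback_vertex_set H S" "card S = 1"
    using fvn by (auto simp: feedback_vertex_number_def)
  then obtain v where v: "S = {v}" by (auto simp: card_1_singleton_iff)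
  have "\<not> acyclic_graph H"
  proof
    assume "acyclic_graph H"
    then have "feedback_vertex_set H {}" by (cases H) (simp add: feedback_vertex_set_def delete_verts_def)
    then have "0 \<in> ?C" by force
    then have "Min ?C \<le> 0" using finC by (rule Min_le[rotated])
    then show False using fvn by (simp add: feedback_vertex_number_def)
  qed
  then show ?thesis using that S v by (auto simp: feedback_vertex_set_def acyclic_graph_def)
qed

lemma finite_cycle_lengths:
  assumes "simple_graph H"
  shows "finite {length c |c. is_cycle H c}"
proof (rule finite_subset)
  have fin: "finite (verts H)" using assms by (simp add: simple_graph_def)
  show "{length c |c. is_cycle H c} \<subseteq> {..card (verts H)}"
  proof clarsimp
    fix c assume "is_cycle H c"
    then have "distinct c" "set c \<subseteq> verts H" by (simp_all add: is_cycle_def is_walk_def)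
    then show "length c \<le> card (verts H)" using card_mono[OF fin, of "set c"] by (simp add: distinct_card)
  qed
qed simp

lemma girth_le:
  assumes "simple_graph H" "is_cycle H c"
  shows "girth H \<le> length c"
  unfolding girth_def
  by (rule Min_le[OF finite_cycle_lengths[OF assms(1)]]) (use assms(2) in blast)

lemma girth_ge_3:
  assumes "simple_graph H" "is_cycle H c"
  shows "3 \<le> girth H"
proof -
  have "girth H \<in> {length c |c. is_cycle H c}"
    unfolding girth_def
    by (rule Min_in[OF finite_cycle_lengths[OF assms(1)]]) (use assms(2) in blast)
  then show ?thesis by (auto simp: is_cycle_def)
qed

text \<open>An edge of \<open>H\<close> makes the edgeless graph on \<open>n\<close> vertices free
  of \<open>H\<close>, so the set whose maximum is taken is nonempty; its elements are bounded by
  the number of vertex subsets.\<close>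

lemma ex_attained:
  assumes H: "e \<in> edges H" "simple_graph H"
  shows "\<exists>G :: nat ugraph. simple_graph G \<and> card (verts G) = n \<and> \<not> contains_copy G H \<and> ex n H = card (edges G)"
proof -
  let ?S = "{card (edges G) | G :: nat ugraph. simple_graph G \<and> card (verts G) = n \<and> \<not> contains_copy G H}"
  have "?S \<subseteq> {..2 ^ n}"
  proof
    fix m assume "m \<in> ?S"
    then obtain G :: "nat ugraph" where G: "simple_graph G" "card (verts G) = n" "m = card (edges G)" by blast
    then have "edges G \<subseteq> Pow (verts G)" "finite (verts G)" by (auto simp: simple_graph_def)
    then have "m \<le> card (Pow (verts G))" using G(3) by (simp add: card_mono)
    then show "m \<in> {..2 ^ n}" using G(2) \<open>finite (verts G)\<close> by (simp add: card_Pow)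
  qed
  then have fin: "finite ?S" using finite_subset by blast
  have "simple_graph \<lparr>verts = {..<n}, edges = {}\<rparr>" "card (verts \<lparr>verts = {..<n}, edges = {}\<rparr>) = n"
    by (auto simp: simple_graph_def)
  moreover have "\<not> contains_copy \<lparr>verts = {..<n}, edges = {}\<rparr> H"
  proof
    assume "contains_copy \<lparr>verts = {..<n}, edges = {}\<rparr> H"
    then obtain F f where F: "edges F = {}"
      "\<And>u v. u \<in> verts H \<Longrightarrow> v \<in> verts H \<Longrightarrow> {u, v} \<in> edges H \<longleftrightarrow> {f u, f v} \<in> edges (F :: nat ugraph)"
      unfolding contains_copy_def is_subgraph_def graph_iso_def by auto
    have "card e = 2" "e \<subseteq> verts H" using H by (auto simp: simple_graph_def)
    then obtain u v where "e = {u, v}" "u \<in> verts H" "v \<in> verts H" by (auto simp: card_2_iff)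
    then show False using F H(1) by auto
  qed
  ultimately have "?S \<noteq> {}" by blast
  from Min_in[OF fin this] Max_in[OF fin this] show ?thesis unfolding ex_def by auto
qed

lemma dense_graph_contains_copy:
  fixes G :: "'b ugraph" and \<delta> :: real
  assumes H: "simple_graph H" "connected_graph H" "bipartite_graph H" and v: "v \<in> verts H"
    and fvs: "acyclic_graph (delete_verts H {v})"
    and girth: "\<And>c. is_cycle H c \<Longrightarrow> 2 * k \<le> length c" and k: "2 \<le> k"
    and D: "D = Suc (card (verts H))" and K: "K = 2 * real (D * k ^ 2)"
    and delta: "2 ^ (k + 3) * (real k + 1) * real D \<le> \<delta>"
    and big: "\<delta> ^ k > 2 * K ^ (2 * k - 1) * real (card (verts G))"
    and G: "simple_graph G" "\<delta> * real (card (verts G)) < real (card (edges G))"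
  shows "contains_copy G H"
proof -
  obtain U where U: "U \<subseteq> verts G" "U \<noteq> {}"
    "\<And>v. v \<in> U \<Longrightarrow> \<delta> \<le> real (card {u \<in> U. {u, v} \<in> edges G})"
    using min_degree_subgraph[OF G] by blast
  have no_loop: "{a} \<notin> edges G" for a
    using G(1) by (auto simp: simple_graph_def)
  have finU: "finite U" using U(1) G(1) finite_subset by (auto simp: simple_graph_def)
  define E where "E a b \<longleftrightarrow> a \<in> U \<and> b \<in> U \<and> {a, b} \<in> edges G" for a b
  have D1: "1 \<le> real D" using D by simp
  have "2 ^ (k + 3) * (real k + 1) * 1 \<le> 2 ^ (k + 3) * (real k + 1) * real D"
    using D1 by (intro mult_left_mono) auto
  then have d1: "2 ^ (k + 3) * (real k + 1) \<le> \<delta>" using delta by linarith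
  have "1 * 1 \<le> 2 ^ (k + 3) * (real k + 1)" by (intro mult_mono) auto
  then have d0: "1 \<le> \<delta>" using d1 by linarith
  have "real 1 \<le> real (D * k ^ 2)" unfolding of_nat_le_iff using D k by (simp add: Suc_le_eq)
  then have K1: "1 < K" using K by simp
  interpret dense_graph U E \<delta> K
  proof
    fix v assume v: "v \<in> U"
    have "{u. E v u} = {u \<in> U. {u, v} \<in> edges G}" using v by (auto simp: E_def insert_commute)
    then show "\<delta> \<le> real (card {u. E v u})" using U(3)[OF v] by simp
  qed (use finU U(2) d0 K1 no_loop in \<open>auto simp: E_def insert_commute\<close>)
  \<comment> \<open>Then \<open>2 ^ k * \<epsilon> = 1 / 4\<close>, while \<open>delta\<close>
    bounds the other term of the smallness condition by \<open>1 / 8\<close>; and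
    \<open>\<epsilon> * 2 ^ (k + 3) = 2\<close> yields the last condition on
    \<open>\<delta>\<close>.\<close>
  define \<epsilon> :: real where "\<epsilon> = 1 / 2 ^ (k + 2)"
  have "\<exists>l x A. 2 \<le> l \<and> l \<le> k \<and> level_host E x A l D \<and> (\<forall>i\<le>l. A i \<subseteq> U)"
  proof (rule level_host_exists)
    have "2 * K ^ (2 * k - 1) * real (card U) \<le> 2 * K ^ (2 * k - 1) * real (card (verts G))"
      using card_mono[OF _ U(1)] G(1) K1 by (intro mult_left_mono) (auto simp: simple_graph_def)
    then show "2 * K ^ (2 * k - 1) * real (card U) < \<delta> ^ k" using big by linarith
    have "2 ^ k * (real k + 1) / \<delta> \<le> 1 / 8"
      using d1 d0 by (simp add: field_simps power_add)
    moreover have "2 ^ k * (\<epsilon> + (real k + 1) / \<delta>) = 2 ^ k * \<epsilon> + 2 ^ k * (real k + 1) / \<delta>"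
      by (simp add: distrib_left)
    moreover have "2 ^ k * \<epsilon> = 1 / 4" by (simp add: \<epsilon>_def power_add)
    ultimately show "2 ^ k * (\<epsilon> + (real k + 1) / \<delta>) \<le> 1 / 2" by linarith
    have "2 * real k * real D < 2 * (real k + 1) * real D" using D1 by simp
    also have "\<dots> = \<epsilon> * (2 ^ (k + 3) * (real k + 1) * real D)"
      by (simp add: \<epsilon>_def power_add)
    also have "\<dots> \<le> \<epsilon> * \<delta>" using delta by (intro mult_left_mono) (auto simp: \<epsilon>_def)
    finally show "2 * real k * real D < \<epsilon> * \<delta>" .
  qed (use k K in \<open>auto simp: \<epsilon>_def\<close>)
  then obtain l x A where l: "2 \<le> l" "l \<le> k" and host: "level_host E x A l D"
    and AU: "\<And>i. i \<le> l \<Longrightarrow> A i \<subseteq> U" by blast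
  interpret levelled_forest "verts H" "\<lambda>a b. {a, b} \<in> edges H" v "dist_from H v" l
    by (rule levelled_forest_of_graph[OF H v fvs girth l])
  obtain f where f: "embeds E A (verts H) f"
    using embedding_exists[OF E_sym host] D by auto
  show ?thesis
  proof (rule contains_copy_of_embedding[OF H(1)])
    show "inj_on f (verts H)" using f by (simp add: embeds_def)
    show "f ` verts H \<subseteq> verts G"
      using f AU target_le U(1) by (fastforce simp: embeds_def)
    show "{f a, f b} \<in> edges G" if "{a, b} \<in> edges H" for a b
      using f that R_in R_in2 by (fastforce simp: embeds_def E_def)
  qed
qed

theorem theorem1p1:
  fixes H :: "'a ugraph" and k :: nat
  assumes "simple_graph H"
    and "connected_graph H"
    and "bipartite_graph H"
    and "feedback_vertex_number H = 1"
    and "girth H = 2 * k"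
  shows "(\<lambda>n. real (ex n H)) \<in> O(\<lambda>n. real n powr (1 + 1 / real k))"
proof -
  obtain v c where v: "v \<in> verts H" "acyclic_graph (delete_verts H {v})" and c: "is_cycle H c"
    using feedback_vertex_number_1[OF assms(1,4)] by blast
  have k: "2 \<le> k" using girth_ge_3[OF assms(1) c] assms(5) by simp
  have girth: "2 * k \<le> length c" if "is_cycle H c" for c
    using girth_le[OF assms(1) that] assms(5) by simp
  define D where "D = Suc (card (verts H))"
  define K where "K = 2 * real (D * k ^ 2)"
  \<comment> \<open>A common bound for the constants required by
    \<open>dense_graph_contains_copy\<close>; the final \<open>1\<close> gives
    \<open>B \<ge> 1\<close> and a strict inequality.\<close>
  define B where "B = 2 ^ (k + 3) * (real k + 1) * real D + 2 * K ^ (2 * k - 1) + 1"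
  have K0: "0 \<le> K" by (simp add: K_def)
  then have B: "1 \<le> B" "2 ^ (k + 3) * (real k + 1) * real D \<le> B" "2 * K ^ (2 * k - 1) < B"
    unfolding B_def by (auto intro: add_nonneg_pos)
  have "real (ex n H) \<le> B * real n powr (1 + 1 / real k)" if n: "1 \<le> n" for n
  proof -
    obtain G :: "nat ugraph" where G: "simple_graph G" "card (verts G) = n" "\<not> contains_copy G H"
      "ex n H = card (edges G)"
      using ex_attained[OF _ assms(1)] c by (auto simp: is_cycle_def)
    \<comment> \<open>Since \<open>\<delta> ^ k = B ^ k * n \<ge> B * n\<close>, this choice meets
      the condition comparing \<open>\<delta> ^ k\<close> with the number of vertices, and
      \<open>\<delta> * n\<close> is the claimed bound.\<close>
    define \<delta> where "\<delta> = B * real n powr (1 / real k)"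
    have p1: "1 \<le> real n powr (1 / real k)" using n by (intro ge_one_powr_ge_zero) auto
    then have "B \<le> \<delta>" using B(1) by (simp add: \<delta>_def)
    moreover have "\<delta> ^ k = B ^ k * real n"
    proof -
      have "(real n powr (1 / real k)) ^ k = real n"
        using n k by (simp add: powr_realpow[symmetric] powr_powr)
      then show ?thesis by (simp add: \<delta>_def power_mult_distrib)
    qed
    moreover have "B \<le> B ^ k" using B(1) k by (intro self_le_power) auto
    ultimately have "2 * K ^ (2 * k - 1) * real n < \<delta> ^ k"
      using B(3) n by (simp add: mult_strict_right_mono)
    moreover have "2 ^ (k + 3) * (real k + 1) * real D \<le> \<delta>" using \<open>B \<le> \<delta>\<close> B(2) by linarith
    ultimately have "\<not> \<delta> * real n < real (card (edges G))"
      using dense_graph_contains_copy[OF assms(1-3) v girth k D_def K_def _ _ G(1)] G by auto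
    moreover have "B * real n powr (1 + 1 / real k) = \<delta> * real n"
      using n by (simp add: \<delta>_def powr_add)
    ultimately show ?thesis using G(4) by simp
  qed
  then have "\<forall>\<^sub>F n in at_top. norm (real (ex n H)) \<le> B * norm (real n powr (1 + 1 / real k))"
    by (intro eventually_at_top_linorderI[of 1]) auto
  then show ?thesis by (rule bigoI)
qed

end
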